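(* Let $K$ be an uncountable compact metrizable space which is a $C$-space. Then $C_w(K)$ and $C_p(K)$ are not homeomorphic.
   Context: For a compact space $K$, $C(K)$ is the set of all continuous real-valued functions on $K$. $C_p(K)$ denotes $C(K)$ endowed with the topology of pointwise convergence on $K$. $C_w(K)$ denotes $C(K)$ endowed with the weak topology of the Banach space $(C(K),\|\cdot\|_\infty)$. A normal space $K$ is called a $C$-space if for any sequence $(\mathcal{U}_i)_{i\in\omega}$ of open covers of $K$ there exists a sequence $(\mathcal{V}_i)_{i\in\omega}$ of families of pairwise disjoint open subsets of $K$ (sets in the same family $\mathcal{V}_i$ are pairwise disjoint) such that each $\mathcal{V}_i$ is a refinement of $\mathcal{U}_i$ (every member of $\mathcal{V}_i$ is contained in some member of $\mathcal{U}_i$; $\mathcal V_i$ itself need not cover $K$) and $\bigcup_{i\in\omega}\mathcal{V}_i$ is a cover of $K$. Here $\omega$ is the set of non-negative integers. *)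

theory Defs
  imports "HOL-Analysis.Analysis"
begin

definition refines :: "'a set set \<Rightarrow> 'a set set \<Rightarrow> bool" where
  "refines \<V> \<U> \<longleftrightarrow> (\<forall>V\<in>\<V>. \<exists>U\<in>\<U>. V \<subseteq> U)"

definition open_cover :: "'a topology \<Rightarrow> 'a set set \<Rightarrow> bool" where
  "open_cover X \<U> \<longleftrightarrow> (\<forall>U\<in>\<U>. openin X U) \<and> \<Union>\<U> = topspace X"

(* A single family \<V> i need not cover the space; only the union of all of them does. *)
definition C_space :: "'a topology \<Rightarrow> bool" where
  "C_space X \<longleftrightarrow> normal_space X \<and>
     (\<forall>\<U> :: nat \<Rightarrow> 'a set set. (\<forall>i. open_cover X (\<U> i)) \<longrightarrow>
        (\<exists>\<V> :: nat \<Rightarrow> 'a set set.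
           (\<forall>i. (\<forall>V\<in>\<V> i. openin X V) \<and> pairwise disjnt (\<V> i) \<and> refines (\<V> i) (\<U> i)) \<and>
           open_cover X (\<Union>i. \<V> i)))"

(* The space K is the whole type 'a. When it is compact, every continuous real function on it is
   bounded (lemma below), so the Banach space C(K) with the supremum norm is the type
   'a \<Rightarrow>\<^sub>C real. *)
lemma continuous_in_bcontfun_if_compact:
  fixes f :: "'a::topological_space \<Rightarrow> real"
  assumes "compact (UNIV :: 'a set)" "continuous_on UNIV f"
  shows "f \<in> bcontfun"
  unfolding bcontfun_def
  using assms(2) compact_imp_bounded[OF compact_continuous_image[OF assms(2,1)]] by blast

(* The topology inherited from the power of the real line. *)
definition pointwise_topology :: "('a::topological_space \<Rightarrow>\<^sub>C real) topology" where
  "pointwise_topology = pullback_topology UNIV apply_bcontfun (powertop_real UNIV)"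

(* The coarsest topology for which all bounded linear functionals are continuous. *)
definition weak_topology :: "'b::real_normed_vector topology" where
  "weak_topology =
     topology_generated_by {blinfun_apply \<phi> -` U |(\<phi> :: 'b \<Rightarrow>\<^sub>L real) U. open U}"

lemma topspace_pointwise_topology [simp]: "topspace pointwise_topology = UNIV"
  by (simp add: pointwise_topology_def topspace_pullback_topology)

lemma topspace_weak_topology [simp]:
  "topspace (weak_topology :: 'b::real_normed_vector topology) = UNIV"
proof -
  have "UNIV \<in> {blinfun_apply \<phi> -` U |(\<phi> :: 'b \<Rightarrow>\<^sub>L real) U. open U}"
    by (rule CollectI, rule exI[of _ 0], rule exI[of _ UNIV]) simp
  then show ?thesis
    unfolding weak_topology_def topology_generated_by_topspace
    by (rule UNIV_eq_I[symmetric, OF UnionI]) (rule UNIV_I)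
qed

end

theory Submission
  imports Defs
begin

text \<open>
  Let \<open>\<Phi>\<close> be a homeomorphism from the pointwise to the weak topology. For \<open>t\<close> in the Hilbert cube let
  \<open>\<mu>\<^sub>t\<close> be the functional \<open>\<Sum>i. 2\<^sup>-\<^sup>i t\<^sub>i \<delta>(x\<^sub>i)\<close>, where the points \<open>x\<^sub>i\<close> form a discrete subset of \<open>K\<close>. By continuity
  of \<open>\<Phi>\<close> at \<open>0\<close>, some basic neighbourhood of \<open>0\<close>, given by an \<open>n\<close>-tuple \<open>y\<close> of points of \<open>K\<close> and a
  bound \<open>1/(m+1)\<close>, is mapped into \<open>{v. \<bar>\<mu>\<^sub>t(v - \<Phi> 0)\<bar> \<le> 1}\<close>. Two observations:
  (1) For fixed \<open>y\<close>, all such \<open>\<mu>\<^sub>t\<close> vanish on a subspace of finite codimension, because the image of the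
  neighbourhood is weakly open. So the corresponding set of \<open>t\<close> is finite-dimensional.
  (2) If \<open>n\<close> is minimal for \<open>t\<close>, then the tuples \<open>y\<close> admissible for \<open>t\<close> are isolated from each other.
  Hence countably many compact relations between the cube and powers of \<open>K\<close>, with finite-dimensional
  fibres over the powers of \<open>K\<close>, are such that each \<open>t\<close> has exactly one partner in one of them. As \<open>K\<close>
  is a C-space this would make the cube weakly infinite-dimensional, contradicting Brouwer's theorem
  (here in the form of Kuhn's combinatorial lemma).
\<close>

section \<open>Partitions between opposite faces of the Hilbert cube\<close>

text \<open>\<open>u i\<close> and \<open>v i\<close> are only asked to miss a face, not to contain
  one, so both may be empty and a piece need not use every coordinate in \<open>N\<close>.\<close>

definition separating ::
    "('b::topological_space \<Rightarrow> nat \<Rightarrow> real) \<Rightarrow> nat set \<Rightarrow> (nat \<Rightarrow> 'b set) \<Rightarrow> (nat \<Rightarrow> 'b set) \<Rightarrow> bool" where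
  "separating f N u v \<longleftrightarrow> (\<forall>i\<in>N. open (u i) \<and> open (v i) \<and> u i \<inter> v i = {} \<and>
       (\<forall>x\<in>u i. f x i < 1) \<and> (\<forall>x\<in>v i. 0 < f x i))"

definition separates :: "('b::topological_space \<Rightarrow> nat \<Rightarrow> real) \<Rightarrow> nat set \<Rightarrow> 'b set \<Rightarrow> bool" where
  "separates f N S \<longleftrightarrow> (\<exists>u v. separating f N u v \<and> S \<subseteq> (\<Union>i\<in>N. u i \<union> v i))"

lemma separatingI:
  assumes "\<And>i. i \<in> N \<Longrightarrow> open (u i)" "\<And>i. i \<in> N \<Longrightarrow> open (v i)" "\<And>i. i \<in> N \<Longrightarrow> u i \<inter> v i = {}"
    "\<And>i x. i \<in> N \<Longrightarrow> x \<in> u i \<Longrightarrow> f x i < 1" "\<And>i x. i \<in> N \<Longrightarrow> x \<in> v i \<Longrightarrow> 0 < f x i"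
  shows "separating f N u v"
  using assms unfolding separating_def by simp

lemma separatingD:
  assumes "separating f N u v" "i \<in> N"
  shows "open (u i)" "open (v i)" "u i \<inter> v i = {}"
    "\<And>x. x \<in> u i \<Longrightarrow> f x i < 1" "\<And>x. x \<in> v i \<Longrightarrow> 0 < f x i"
  using assms unfolding separating_def by simp_all

text \<open>
  The coordinate maps \<open>f\<close> model a map into the Hilbert cube: \<open>u i\<close> misses the face \<open>f x i = 1\<close> and
  \<open>v i\<close> misses the face \<open>f x i = 0\<close>. Quantifying over all infinite sets of coordinates makes the
  notion stable under countable unions: each piece uses coordinates of its own.
\<close>

definition partitionable :: "('b::topological_space \<Rightarrow> nat \<Rightarrow> real) \<Rightarrow> 'b set \<Rightarrow> bool" where
  "partitionable f S \<longleftrightarrow> (\<forall>N. infinite N \<longrightarrow> separates f N S)"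

section \<open>The Hilbert cube and Brouwer's theorem\<close>

definition cube :: "(nat \<Rightarrow> real) set" where
  "cube = (\<Pi>\<^sub>E i\<in>UNIV. {0..1})"

lemma mem_cube: "t \<in> cube \<longleftrightarrow> (\<forall>i. 0 \<le> t i \<and> t i \<le> 1)"
  by (auto simp: cube_def PiE_iff)

lemma compact_PiE_UNIV:
  fixes C :: "'i \<Rightarrow> 'c::topological_space set"
  assumes "\<And>i. compact (C i)"
  shows "compact (\<Pi>\<^sub>E i\<in>UNIV. C i)"
  using compactin_PiE[of "\<lambda>_. euclidean :: 'c topology" UNIV C] assms
  by (simp add: euclidean_product_topology)

lemma compact_cube: "compact cube"
  unfolding cube_def by (rule compact_PiE_UNIV) simp

lemma tendsto_coordinatewise:
  fixes X :: "nat \<Rightarrow> 'i \<Rightarrow> 'c::topological_space"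
  assumes "\<And>i. (\<lambda>n. X n i) \<longlonglongrightarrow> t i"
  shows "X \<longlonglongrightarrow> t"
  using assms limitin_componentwise[of "\<lambda>_. euclidean :: 'c topology" UNIV X t sequentially]
  by (simp add: euclidean_product_topology)

lemma tendsto_coordinate:
  fixes X :: "nat \<Rightarrow> 'i \<Rightarrow> 'c::topological_space"
  assumes "X \<longlonglongrightarrow> t"
  shows "(\<lambda>n. X n i) \<longlonglongrightarrow> t i"
  using assms limitin_componentwise[of "\<lambda>_. euclidean :: 'c topology" UNIV X t sequentially]
  by (simp add: euclidean_product_topology)

text \<open>By compactness finitely many coordinates \<open>i < n\<close> already cover the cube.
  Setting all others to 0 leaves an n-cube, where the claim is a form of Brouwer's theorem.\<close>

lemma not_separates_cube: "\<not> separates (\<lambda>t. t) UNIV cube"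
proof
  assume "separates (\<lambda>t. t) UNIV cube"
  then obtain u v where uv: "separating (\<lambda>t. t) UNIV u v" and cov: "cube \<subseteq> (\<Union>i. u i \<union> v i)"
    unfolding separates_def by blast
  note op = separatingD(1,2)[OF uv UNIV_I] and dis = separatingD(3)[OF uv UNIV_I]
    and u1 = separatingD(4)[OF uv UNIV_I] and v0 = separatingD(5)[OF uv UNIV_I]
  obtain I where "finite I" and I: "cube \<subseteq> (\<Union>i\<in>I. u i \<union> v i)"
    by (rule compactE_image[OF compact_cube, of UNIV "\<lambda>i. u i \<union> v i"]) (use op cov in auto)
  then obtain n where n: "I \<subseteq> {..<n}"
    using finite_nat_iff_bounded by blast
  \<comment> \<open>A grid point gets label 1 in direction \<open>i\<close> if it lies in \<open>v i\<close> or on the face \<open>t i = 1\<close>. Small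
    Kuhn cubes with mixed labels accumulate at a point outside \<open>u i\<close> and \<open>v i\<close> for all \<open>i < n\<close>.\<close>
  define pt where "pt p q = (\<lambda>i. if i < n then real (q i) / real p else 0)" for p and q :: "nat \<Rightarrow> nat"
  define lab where "lab p q i = (if q i = p \<or> pt p q \<in> v i then 1 else 0 :: nat)" for p q i
  have "\<exists>q. (\<forall>i<n. q i < Suc k) \<and>
      (\<forall>i<n. \<exists>r s. (\<forall>j<n. q j \<le> r j \<and> r j \<le> q j + 1) \<and>
        (\<forall>j<n. q j \<le> s j \<and> s j \<le> q j + 1) \<and> lab (Suc k) r i \<noteq> lab (Suc k) s i)"
    (is "\<exists>q. ?Q k q") for k
  proof -
    \<comment> \<open>\<open>v i\<close> misses the face with i-th coordinate 0, which gives Kuhn's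
      condition on that face.\<close>
    have lab0: "lab (Suc k) q i = 0" if "i < n" "q i = 0" for q i
      using v0[of "pt (Suc k) q" i] that by (auto simp: lab_def pt_def)
    show ?thesis
    proof (rule kuhn_lemma[of "Suc k" n "lab (Suc k)"])
      show "\<forall>x. (\<forall>i<n. x i \<le> Suc k) \<longrightarrow> (\<forall>i<n. lab (Suc k) x i = 0 \<or> lab (Suc k) x i = 1)"
        "\<forall>x. (\<forall>i<n. x i \<le> Suc k) \<longrightarrow> (\<forall>i<n. x i = Suc k \<longrightarrow> lab (Suc k) x i = 1)"
        by (simp_all add: lab_def)
      show "\<forall>x. (\<forall>i<n. x i \<le> Suc k) \<longrightarrow> (\<forall>i<n. x i = 0 \<longrightarrow> lab (Suc k) x i = 0)"
        using lab0 by blast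
    qed blast+
  qed
  then have "\<exists>q. \<forall>k. ?Q k (q k)" by (intro choice allI)
  then obtain q where qQ: "\<forall>k. ?Q k (q k)" by (rule exE)
  have q: "q k i < Suc k" if "i < n" for k i
    using spec[OF qQ, of k] that by simp
  have "pt (Suc k) (q k) \<in> cube" for k
    using less_imp_le[OF q[of _ k]] by (auto simp: mem_cube pt_def divide_le_eq_1 simp flip: of_nat_Suc)
  then obtain t \<phi> where t: "t \<in> cube" and "strict_mono \<phi>"
    and lim: "((\<lambda>k. pt (Suc k) (q k)) \<circ> \<phi>) \<longlonglongrightarrow> t"
    using seq_compactE[OF compact_imp_seq_compact[OF compact_cube]] by metis
  \<comment> \<open>The Kuhn cubes have side length tending to 0, so any choice of points in them
    has the same limit as their corners.\<close>
  have near: "(\<lambda>k. pt (Suc (\<phi> k)) (r k)) \<longlonglongrightarrow> t"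
    if r: "\<And>k j. j < n \<Longrightarrow> q (\<phi> k) j \<le> r k j \<and> r k j \<le> q (\<phi> k) j + 1" for r
  proof (rule tendsto_coordinatewise)
    fix j
    have l: "(\<lambda>k. pt (Suc (\<phi> k)) (q (\<phi> k)) j) \<longlonglongrightarrow> t j"
      using tendsto_coordinate[OF lim, of j] by (simp add: o_def)
    have z: "(\<lambda>k. inverse (real (Suc (\<phi> k)))) \<longlonglongrightarrow> 0"
      using LIMSEQ_subseq_LIMSEQ[OF LIMSEQ_inverse_real_of_nat \<open>strict_mono \<phi>\<close>]
      by (simp add: o_def)
    have "norm (pt (Suc (\<phi> k)) (r k) j - pt (Suc (\<phi> k)) (q (\<phi> k)) j) \<le> inverse (real (Suc (\<phi> k)))"
      for k
    proof (cases "j < n")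
      case True
      then have "\<bar>real (r k j) - real (q (\<phi> k) j)\<bar> \<le> 1"
        using r[OF True, of k] by linarith
      then have "\<bar>real (r k j) - real (q (\<phi> k) j)\<bar> / real (Suc (\<phi> k)) \<le> 1 / real (Suc (\<phi> k))"
        by (rule divide_right_mono) simp
      then show ?thesis
        using True by (simp add: pt_def inverse_eq_divide abs_divide del: of_nat_Suc flip: diff_divide_distrib)
    qed (simp add: pt_def)
    then have "(\<lambda>k. pt (Suc (\<phi> k)) (r k) j - pt (Suc (\<phi> k)) (q (\<phi> k)) j) \<longlonglongrightarrow> 0"
      by (intro Lim_null_comparison[OF _ z]) simp
    from tendsto_add[OF this l] show "(\<lambda>k. pt (Suc (\<phi> k)) (r k) j) \<longlonglongrightarrow> t j"
      by simp
  qed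
  obtain i where i: "i < n" and ti: "t \<in> u i \<union> v i"
    using t I n by blast
  have "\<exists>r s. (\<forall>j<n. q (\<phi> k) j \<le> r j \<and> r j \<le> q (\<phi> k) j + 1) \<and>
      (\<forall>j<n. q (\<phi> k) j \<le> s j \<and> s j \<le> q (\<phi> k) j + 1) \<and>
      lab (Suc (\<phi> k)) r i \<noteq> lab (Suc (\<phi> k)) s i" (is "\<exists>r s. ?R k r s") for k
    using spec[OF qQ, of "\<phi> k"] i by simp
  then have "\<exists>r. \<forall>k. \<exists>s. ?R k (r k) s" by (intro choice allI)
  then obtain r where "\<forall>k. \<exists>s. ?R k (r k) s" by (rule exE)
  then have "\<exists>s. \<forall>k. ?R k (r k) (s k)" by (rule choice)
  then obtain s where R: "\<forall>k. ?R k (r k) (s k)" by (rule exE)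
  have r: "q (\<phi> k) j \<le> r k j \<and> r k j \<le> q (\<phi> k) j + 1"
    and s: "q (\<phi> k) j \<le> s k j \<and> s k j \<le> q (\<phi> k) j + 1" if "j < n" for k j
    using spec[OF R, of k] that by simp_all
  have ne: "lab (Suc (\<phi> k)) (r k) i \<noteq> lab (Suc (\<phi> k)) (s k) i" for k
    using spec[OF R, of k] by simp
  show False
  proof (cases "t \<in> v i")
    case True
    have "eventually (\<lambda>k. pt (Suc (\<phi> k)) (r k) \<in> v i \<and> pt (Suc (\<phi> k)) (s k) \<in> v i) sequentially"
      using topological_tendstoD[OF near[OF r] op(2) True]
        topological_tendstoD[OF near[OF s] op(2) True] by (rule eventually_conj)
    then obtain k where "pt (Suc (\<phi> k)) (r k) \<in> v i" "pt (Suc (\<phi> k)) (s k) \<in> v i"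
      by (auto simp: eventually_sequentially)
    then show False
      using ne[of k] by (simp add: lab_def)
  next
    case False
    with ti have ti: "t \<in> u i" by simp
    have "eventually (\<lambda>k. pt (Suc (\<phi> k)) (r k) \<in> u i \<and> pt (Suc (\<phi> k)) (s k) \<in> u i) sequentially"
      using topological_tendstoD[OF near[OF r] op(1) ti]
        topological_tendstoD[OF near[OF s] op(1) ti] by (rule eventually_conj)
    then obtain k where k: "pt (Suc (\<phi> k)) (r k) \<in> u i" "pt (Suc (\<phi> k)) (s k) \<in> u i"
      by (auto simp: eventually_sequentially)
    \<comment> \<open>A point of \<open>u i\<close> lies neither on the face where the i-th
      coordinate is 1 nor in \<open>v i\<close>.\<close>
    have "lab (Suc (\<phi> k)) x i = 0" if "pt (Suc (\<phi> k)) x \<in> u i" for x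
      using u1[OF that] dis[of i] that i by (auto simp: lab_def pt_def)
    with k ne[of k] show False by simp
  qed
qed

section \<open>Countable unions\<close>

lemma separates_subset: "separates f N S \<Longrightarrow> T \<subseteq> S \<Longrightarrow> separates f N T"
  unfolding separates_def by (meson order_trans)

lemma infinite_nat_split:
  assumes "infinite (N :: nat set)"
  obtains M where "\<And>j::nat. infinite (M j)" "\<And>j. M j \<subseteq> N" "disjoint_family M"
proof -
  obtain e where e: "bij_betw e (UNIV :: nat set) N"
    using assms bij_enumerate by blast
  define M where "M j = (\<lambda>k. e (prod_encode (j, k))) ` UNIV" for j
  have inj: "inj e" using e by (simp add: bij_betw_def)
  show ?thesis
  proof (rule that[of M])
    show "infinite (M j)" for j
      unfolding M_def
      by (rule range_inj_infinite) (auto simp: inj_on_def inj_eq[OF inj])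
    show "M j \<subseteq> N" for j
      using e by (auto simp: M_def bij_betw_def)
    show "disjoint_family M"
      by (auto simp: disjoint_family_on_def M_def inj_eq[OF inj])
  qed
qed

lemma separates_Union_family:
  fixes S :: "nat \<Rightarrow> 'b::topological_space set"
  assumes "disjoint_family M" "\<And>j. M j \<subseteq> N" "\<And>j. separates f (M j) (S j)"
  shows "separates f N (\<Union>j. S j)"
proof -
  have "\<exists>u v. separating f (M j) u v \<and> S j \<subseteq> (\<Union>i\<in>M j. u i \<union> v i)" for j
    using assms(3)[of j] unfolding separates_def .
  then obtain u v where uv: "\<And>j. separating f (M j) (u j) (v j)"
    and cov: "\<And>j. S j \<subseteq> (\<Union>i\<in>M j. u j i \<union> v j i)"
    by metis
  define J where "J i = (THE j. i \<in> M j)" for i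
  have J: "J i = j" if "i \<in> M j" for i j
    unfolding J_def using that assms(1) by (intro the_equality) (auto simp: disjoint_family_on_def)
  \<comment> \<open>Each coordinate serves the unique piece owning it; \<open>J i\<close> is
    meaningless for a coordinate outside all \<open>M j\<close>, where the empty set is
    used.\<close>
  define u' where "u' i = (if i \<in> (\<Union>j. M j) then u (J i) i else {})" for i
  define v' where "v' i = (if i \<in> (\<Union>j. M j) then v (J i) i else {})" for i
  have eq: "u' i = u j i" "v' i = v j i" if "i \<in> M j" for i j
    using that by (auto simp: u'_def v'_def J)
  have "separating f N u' v'"
    unfolding separating_def
  proof
    fix i
    show "open (u' i) \<and> open (v' i) \<and> u' i \<inter> v' i = {} \<and> (\<forall>x\<in>u' i. f x i < 1) \<and> (\<forall>x\<in>v' i. 0 < f x i)"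
    proof (cases "\<exists>j. i \<in> M j")
      case True
      then obtain j where "i \<in> M j" by blast
      then show ?thesis
        using separatingD[OF uv[of j], of i] by (simp add: eq[of i j])
    next
      case False
      then show ?thesis by (simp add: u'_def v'_def)
    qed
  qed
  moreover have "(\<Union>j. S j) \<subseteq> (\<Union>i\<in>N. u' i \<union> v' i)"
  proof
    fix x assume "x \<in> (\<Union>j. S j)"
    then obtain j where "x \<in> S j" by blast
    then obtain i where "i \<in> M j" "x \<in> u j i \<union> v j i" using cov[of j] by blast
    then have "i \<in> N" "x \<in> u' i \<union> v' i"
      using assms(2)[of j] eq[of i j] by auto
    then show "x \<in> (\<Union>i\<in>N. u' i \<union> v' i)" by blast
  qed
  ultimately show ?thesis
    unfolding separates_def by blast
qed

lemma partitionable_UN_countable: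
  fixes S :: "'j \<Rightarrow> 'b::topological_space set"
  assumes "countable I" "\<And>j. j \<in> I \<Longrightarrow> partitionable f (S j)" "partitionable f {}"
  shows "partitionable f (\<Union>j\<in>I. S j)"
  unfolding partitionable_def
proof (intro allI impI)
  fix N :: "nat set" assume "infinite N"
  then obtain M where M: "\<And>j::nat. infinite (M j)" "\<And>j. M j \<subseteq> N" "disjoint_family M"
    by (rule infinite_nat_split) blast
  show "separates f N (\<Union>j\<in>I. S j)"
  proof (cases "I = {}")
    case True
    then show ?thesis using assms(3) \<open>infinite N\<close> by (simp add: partitionable_def)
  next
    case False
    \<comment> \<open>The enumeration may repeat indices; the pieces need not be disjoint.\<close>
    have "separates f N (\<Union>k. S (from_nat_into I k))"
      using assms(2) M False
      by (intro separates_Union_family[OF M(3)]) (auto simp: partitionable_def from_nat_into)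
    moreover have "(\<Union>j\<in>I. S j) = (\<Union>k. S (from_nat_into I k))"
      using range_from_nat_into[OF False assms(1)] by (metis image_image)
    ultimately show ?thesis by simp
  qed
qed

section \<open>Maps into C-spaces\<close>

lemma C_spaceE:
  fixes U :: "nat \<Rightarrow> 'a set set"
  assumes "C_space X" "\<And>i. open_cover X (U i)"
  obtains G where "\<And>i V. V \<in> G i \<Longrightarrow> openin X V" "\<And>i. pairwise disjnt (G i)"
    "\<And>i. refines (G i) (U i)" "open_cover X (\<Union>i. G i)"
proof -
  have "\<forall>i. open_cover X (U i)" using assms(2) by simp
  then have "\<exists>G. (\<forall>i. (\<forall>V\<in>G i. openin X V) \<and> pairwise disjnt (G i) \<and> refines (G i) (U i)) \<and>
      open_cover X (\<Union>i. G i)"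
    using assms(1) unfolding C_space_def by simp
  then obtain G where "\<forall>i. (\<forall>V\<in>G i. openin X V) \<and> pairwise disjnt (G i) \<and> refines (G i) (U i)"
    "open_cover X (\<Union>i. G i)"
    by (elim exE conjE)
  then show ?thesis by (intro that[of G]) simp_all
qed

text \<open>Partitions of a fibre also work over a neighbourhood of its base point. The C-property
  refines the covers by such neighbourhoods to disjoint families. Within one family the local
  partitions are glued using the same coordinates; different families use disjoint sets of
  coordinates.\<close>

lemma partitionable_preimage:
  fixes S :: "'b::topological_space set" and p :: "'b \<Rightarrow> 'a::topological_space"
  assumes "C_space (euclidean :: 'a topology)" "Hausdorff_space (euclidean :: 'a topology)"
    and "compact S" "continuous_on UNIV p"
    and fibre: "\<And>y. partitionable f (S \<inter> p -` {y})"
  shows "partitionable f S"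
  unfolding partitionable_def
proof (intro allI impI)
  fix N :: "nat set" assume "infinite N"
  then obtain M where M: "\<And>j::nat. infinite (M j)" "\<And>j. M j \<subseteq> N" "disjoint_family M"
    by (rule infinite_nat_split) blast
  have "\<exists>u v. separating f (M j) u v \<and> S \<inter> p -` {y} \<subseteq> (\<Union>i\<in>M j. u i \<union> v i)" for j y
    using fibre[of y] M(1)[of j] unfolding separates_def partitionable_def by blast
  then obtain u v where uv: "\<And>j y. separating f (M j) (u j y) (v j y)"
    and fcov: "\<And>j y. S \<inter> p -` {y} \<subseteq> (\<Union>i\<in>M j. u j y i \<union> v j y i)"
    by metis
  \<comment> \<open>The set of points whose whole fibre in \<open>S\<close> is covered by the pairs
    chosen for \<open>y\<close>. It is open because \<open>p\<close> maps compact sets to closed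
    ones.\<close>
  define W where "W j y = - p ` (S - (\<Union>i\<in>M j. u j y i \<union> v j y i))" for j y
  have yW: "y \<in> W j y" for j y
    using fcov[of y j] by (auto simp: W_def)
  have opW: "open (W j y)" for j y
  proof -
    have "open (\<Union>i\<in>M j. u j y i \<union> v j y i)"
      using separatingD(1,2)[OF uv[of j y]] by (intro open_UN) auto
    then have "compact (p ` (S - (\<Union>i\<in>M j. u j y i \<union> v j y i)))"
      by (intro compact_continuous_image compact_diff assms(3)
          continuous_on_subset[OF assms(4)] subset_UNIV)
    then have "closed (p ` (S - (\<Union>i\<in>M j. u j y i \<union> v j y i)))"
      using compactin_imp_closedin[OF assms(2)] by simp
    then show ?thesis unfolding W_def by (simp add: open_Compl)
  qed
  have "(\<Union>y. W j y) = UNIV" for j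
    using yW[of _ j] by blast
  then have "open_cover euclidean (range (W j))" for j
    unfolding open_cover_def using opW by simp
  then obtain G where G: "\<And>j V. V \<in> G j \<Longrightarrow> openin (euclidean :: 'a topology) V"
    "\<And>j. pairwise disjnt (G j)" "\<And>j. refines (G j) (range (W j))"
    and cov: "open_cover (euclidean :: 'a topology) (\<Union>j. G j)"
    using C_spaceE[OF assms(1), of "\<lambda>j. range (W j)"] by blast
  define Y where "Y j V = (SOME y. V \<subseteq> W j y)" for j V
  have Y: "V \<subseteq> W j (Y j V)" if "V \<in> G j" for j V
  proof -
    have "\<exists>y. V \<subseteq> W j y" using G(3)[of j] that unfolding refines_def by blast
    then show ?thesis unfolding Y_def by (rule someI_ex)
  qed
  \<comment> \<open>Since the members of \<open>G j\<close> are disjoint, a point sees only one of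
    the local choices, and disjointness of the pairs survives the union.\<close>
  define u' where "u' j i = (\<Union>V\<in>G j. p -` V \<inter> u j (Y j V) i)" for j i
  define v' where "v' j i = (\<Union>V\<in>G j. p -` V \<inter> v j (Y j V) i)" for j i
  have "separating f (M j) (u' j) (v' j)" for j
  proof (rule separatingI)
    fix i assume i: "i \<in> M j"
    have pV: "open (p -` V)" if "V \<in> G j" for V
      using G(1) that assms(4) by (simp add: open_vimage)
    show "open (u' j i)" "open (v' j i)"
      unfolding u'_def v'_def using pV separatingD(1,2)[OF uv i] by (auto intro!: open_UN)
    show "u' j i \<inter> v' j i = {}"
    proof (rule ccontr)
      assume "u' j i \<inter> v' j i \<noteq> {}"
      then obtain x V V' where x: "V \<in> G j" "V' \<in> G j" "p x \<in> V" "p x \<in> V'"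
        "x \<in> u j (Y j V) i" "x \<in> v j (Y j V') i"
        unfolding u'_def v'_def by blast
      then have "V = V'" using G(2)[of j] by (auto simp: pairwise_def disjnt_def)
      then show False using x separatingD(3)[OF uv i, of "Y j V"] by blast
    qed
    show "f x i < 1" if "x \<in> u' j i" for x
      using that separatingD(4)[OF uv i] unfolding u'_def by blast
    show "0 < f x i" if "x \<in> v' j i" for x
      using that separatingD(5)[OF uv i] unfolding v'_def by blast
  qed
  moreover have "S \<inter> p -` \<Union>(G j) \<subseteq> (\<Union>i\<in>M j. u' j i \<union> v' j i)" for j
  proof
    fix x assume "x \<in> S \<inter> p -` \<Union>(G j)"
    then obtain V where V: "x \<in> S" "V \<in> G j" "p x \<in> V" by blast
    then have "p x \<in> W j (Y j V)" using Y by blast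
    then obtain i where "i \<in> M j" "x \<in> u j (Y j V) i \<union> v j (Y j V) i"
      using V(1) unfolding W_def by blast
    then show "x \<in> (\<Union>i\<in>M j. u' j i \<union> v' j i)"
      using V unfolding u'_def v'_def by blast
  qed
  ultimately have sep: "separates f (M j) (S \<inter> p -` \<Union>(G j))" for j
    unfolding separates_def by blast
  have "separates f N (\<Union>j. S \<inter> p -` \<Union>(G j))"
    by (rule separates_Union_family[OF M(3,2) sep])
  moreover have "S \<subseteq> (\<Union>j. S \<inter> p -` \<Union>(G j))"
  proof
    fix x assume "x \<in> S"
    have "p x \<in> \<Union>(\<Union>j. G j)" using cov by (simp add: open_cover_def)
    then show "x \<in> (\<Union>j. S \<inter> p -` \<Union>(G j))" using \<open>x \<in> S\<close> by blast
  qed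
  ultimately show "separates f N S" by (rule separates_subset)
qed

text \<open>The maps are handled one at a time, so only the factor space and not its powers has to
  be a C-space.\<close>

lemma partitionable_joint_preimage:
  fixes S :: "'b::topological_space set" and p :: "nat \<Rightarrow> 'b \<Rightarrow> 'a::topological_space"
  assumes C: "C_space (euclidean :: 'a topology)" and H: "Hausdorff_space (euclidean :: 'a topology)"
    and p: "\<And>l. l < n \<Longrightarrow> continuous_on UNIV (p l)"
    and "compact S"
    and "\<And>y. partitionable f {x \<in> S. \<forall>l<n. p l x = y l}"
  shows "partitionable f S"
  using p assms(4,5)
proof (induction n arbitrary: S)
  case 0
  then show ?case by simp
next
  case (Suc n)
  have pc: "continuous_on UNIV (p n)" using Suc.prems(1) by simp
  show ?case
  proof (rule partitionable_preimage[OF C H Suc.prems(2) pc])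
    fix z :: 'a
    have "closed {z}"
      using closedin_Hausdorff_sing_eq[OF H, of z] by simp
    then have "closed (p n -` {z})"
      using pc by (simp add: closed_vimage)
    then have c: "compact (S \<inter> p n -` {z})"
      using Suc.prems(2) by (rule compact_Int_closed[rotated])
    show "partitionable f (S \<inter> p n -` {z})"
    proof (rule Suc.IH[OF _ c])
      fix y :: "nat \<Rightarrow> 'a"
      have "{x \<in> S \<inter> p n -` {z}. \<forall>l<n. p l x = y l} = {x \<in> S. \<forall>l<Suc n. p l x = (y(n := z)) l}"
        by (auto simp: less_Suc_eq)
      then show "partitionable f {x \<in> S \<inter> p n -` {z}. \<forall>l<n. p l x = y l}"
        using Suc.prems(3)[of "y(n := z)"] by simp
    qed (use Suc.prems(1) in simp)
  qed
qed

section \<open>Finite-dimensional sets and projections\<close>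

lemma partitionable_subset: "partitionable f S \<Longrightarrow> T \<subseteq> S \<Longrightarrow> partitionable f T"
  unfolding partitionable_def using separates_subset by blast

lemma partitionable_empty: "partitionable f {}"
proof -
  have "separating f N (\<lambda>_. {}) (\<lambda>_. {})" for N
    by (simp add: separating_def)
  then show ?thesis unfolding partitionable_def separates_def by blast
qed

lemma open_coordinate_halfspaces:
  fixes c :: real
  shows "open {t :: 'i \<Rightarrow> real. t i < c}" "open {t :: 'i \<Rightarrow> real. c < t i}"
  by (intro open_Collect_less continuous_on_product_coordinates continuous_on_const)+

text \<open>The second hypothesis expresses that \<open>f\<close> maps \<open>S\<close> into a space
  of dimension at most \<open>k\<close>: any more than \<open>k\<close> coordinates are linearly
  dependent on \<open>S\<close>.\<close>

lemma partitionable_linear_relations: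
  fixes f :: "'b::topological_space \<Rightarrow> nat \<Rightarrow> real"
  assumes cont: "\<And>i. continuous_on UNIV (\<lambda>x. f x i)"
    and rel: "\<And>I. finite I \<Longrightarrow> k < card I \<Longrightarrow>
      \<exists>a. (\<exists>i\<in>I. a i \<noteq> 0) \<and> (\<forall>x\<in>S. (\<Sum>i\<in>I. a i * f x i) = 0)"
  shows "partitionable f S"
  unfolding partitionable_def
proof (intro allI impI)
  fix N :: "nat set" assume "infinite N"
  then obtain I where I: "finite I" "card I = Suc k" "I \<subseteq> N"
    using infinite_arbitrarily_large by blast
  then obtain a i0 where i0: "i0 \<in> I" "a i0 \<noteq> 0" and a: "\<And>x. x \<in> S \<Longrightarrow> (\<Sum>i\<in>I. a i * f x i) = 0"
    using rel[of I] by auto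
  \<comment> \<open>The hyperplanes \<open>f x i = c i\<close>, \<open>i \<in> I\<close>, have no common point in \<open>S\<close>.\<close>
  have "\<exists>c. (\<forall>i\<in>I. 0 < c i \<and> c i < 1) \<and> (\<Sum>i\<in>I. a i * c i) \<noteq> 0"
  \<comment> \<open>The centre of the cube works unless it satisfies the relation; then moving the
    single coordinate \<open>i0\<close>, where \<open>a i0\<close> is nonzero, violates it.\<close>
  proof (cases "(\<Sum>i\<in>I. a i * (1/2)) = 0")
    case True
    have "(\<Sum>i\<in>I. a i * (if i = i0 then 1/4 else 1/2)) = (\<Sum>i\<in>I. a i * (1/2) - (if i = i0 then a i0 * (1/4) else 0))"
      by (rule sum.cong) auto
    also have "\<dots> = - a i0 * (1/4)"
      using True I(1) i0(1) by (simp add: sum_subtractf)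
    finally show ?thesis
      using i0(2) by (intro exI[of _ "\<lambda>i. if i = i0 then 1/4 else 1/2"]) auto
  next
    case False
    then show ?thesis
      by (intro exI[of _ "\<lambda>_. 1/2"]) auto
  qed
  then obtain c :: "nat \<Rightarrow> real" where c: "\<And>i. i \<in> I \<Longrightarrow> 0 < c i \<and> c i < 1" and ac: "(\<Sum>i\<in>I. a i * c i) \<noteq> 0"
    by blast
  define u where "u i = (if i \<in> I then {x. f x i < c i} else {})" for i
  define v where "v i = (if i \<in> I then {x. c i < f x i} else {})" for i
  have "separating f N u v"
    using c by (intro separatingI)
      (auto simp: u_def v_def intro!: open_Collect_less cont split: if_splits; force)+
  moreover have "S \<subseteq> (\<Union>i\<in>N. u i \<union> v i)"
  proof
    fix x assume "x \<in> S"
    have "\<exists>i\<in>I. f x i \<noteq> c i"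
    proof (rule ccontr)
      assume "\<not> (\<exists>i\<in>I. f x i \<noteq> c i)"
      then have "(\<Sum>i\<in>I. a i * f x i) = (\<Sum>i\<in>I. a i * c i)" by (intro sum.cong) auto
      then show False using a[OF \<open>x \<in> S\<close>] ac by simp
    qed
    then obtain i where i: "i \<in> I" "f x i \<noteq> c i" by blast
    then have "x \<in> u i \<union> v i" by (auto simp: u_def v_def)
    then show "x \<in> (\<Union>i\<in>N. u i \<union> v i)" using i(1) I(3) by blast
  qed
  ultimately show "separates f N S" unfolding separates_def by blast
qed

text \<open>The two sets need not be closed, but they are closed in the complement of
  \<open>H \<inter> L\<close>, which is metrizable and hence normal. Being open in that open
  subspace, the separating sets are open.\<close>

lemma separate_relatively_open:
  fixes Y :: "'b::metric_space set"
  assumes "closed Y" "closed H" "closed L" "Y \<subseteq> H \<union> L"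
  obtains U V where "open U" "open V" "U \<inter> V = {}" "Y - H \<subseteq> U" "Y - L \<subseteq> V"
proof -
  let ?X = "- (H \<inter> L)"
  have oX: "open ?X" using assms by (intro open_Compl closed_Int)
  have n: "normal_space (top_of_set ?X)"
    by (intro metrizable_imp_normal_space metrizable_space_subtopology metrizable_space_euclidean)
  have "Y - H = ?X \<inter> (Y \<inter> L)" "Y - L = ?X \<inter> (Y \<inter> H)"
    using assms(4) by blast+
  then have "closedin (top_of_set ?X) (Y - H)" "closedin (top_of_set ?X) (Y - L)"
    using assms(1-3) by (metis closedin_closed_Int closed_Int)+
  moreover have "disjnt (Y - H) (Y - L)"
    using assms(4) by (auto simp: disjnt_def)
  ultimately obtain U V where "openin (top_of_set ?X) U" "openin (top_of_set ?X) V"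
    "Y - H \<subseteq> U" "Y - L \<subseteq> V" "disjnt U V"
    using n unfolding normal_space_def by meson
  then show ?thesis
    using that[of U V] openin_open_trans[OF _ oX] by (simp add: disjnt_def)
qed

text \<open>A partition of \<open>Z\<close> is pushed down to the first factor. A point with a
  single partner inherits the side on which that partner lies.\<close>

lemma partitionable_unique_section:
  fixes Z :: "((nat \<Rightarrow> real) \<times> 'c::topological_space) set"
  assumes "compact Z" "partitionable fst Z"
  shows "partitionable (\<lambda>t. t) {t. \<exists>!y. (t, y) \<in> Z}"
  unfolding partitionable_def
proof (intro allI impI)
  fix N :: "nat set" assume "infinite N"
  then have "separates fst N Z"
    using assms(2) by (simp add: partitionable_def)
  then obtain u v where uv: "separating fst N u v" and cov: "Z \<subseteq> (\<Union>i\<in>N. u i \<union> v i)"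
    unfolding separates_def by (elim exE conjE)
  have fcl: "closed (fst ` W)" if "compact W" for W :: "((nat \<Rightarrow> real) \<times> 'c) set"
    by (rule compact_imp_closed, rule compact_continuous_image[OF continuous_on_fst[OF continuous_on_id] that])
  have cl: "closed (fst ` Z)" "\<And>W. open W \<Longrightarrow> closed (fst ` (Z - W))"
    using fcl[OF assms(1)] fcl[OF compact_diff[OF assms(1)]] .
  \<comment> \<open>The points of \<open>fst\<close> Z\<open>all of whose partners lie in\<close>u
    i\<open>. By compactness this is open relative to\<close>fst \<open>Z\<close>, though not
    necessarily in the whole space.\<close>
  define u' where "u' i = fst ` Z - fst ` (Z - u i)" for i
  define v' where "v' i = fst ` Z - fst ` (Z - v i)" for i
  have "\<forall>i\<in>N. \<exists>U V. open U \<and> open V \<and> U \<inter> V = {} \<and> u' i \<subseteq> U \<and> v' i \<subseteq> V"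
  proof
    fix i assume i: "i \<in> N"
    have "fst ` Z \<subseteq> fst ` (Z - u i) \<union> fst ` (Z - v i)"
      using separatingD(3)[OF uv i] by blast
    then obtain U V where "open U" "open V" "U \<inter> V = {}" "u' i \<subseteq> U" "v' i \<subseteq> V"
      unfolding u'_def v'_def
      by (rule separate_relatively_open[OF cl(1) cl(2)[OF separatingD(1)[OF uv i]]
          cl(2)[OF separatingD(2)[OF uv i]]])
    then show "\<exists>U V. open U \<and> open V \<and> U \<inter> V = {} \<and> u' i \<subseteq> U \<and> v' i \<subseteq> V" by blast
  qed
  then obtain U where "\<forall>i\<in>N. \<exists>V. open (U i) \<and> open V \<and> U i \<inter> V = {} \<and> u' i \<subseteq> U i \<and> v' i \<subseteq> V"
    by (rule bchoice[elim_format]) blast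
  then obtain V where V: "\<forall>i\<in>N. open (U i) \<and> open (V i) \<and> U i \<inter> V i = {} \<and> u' i \<subseteq> U i \<and> v' i \<subseteq> V i"
    by (rule bchoice[elim_format]) blast
  then have UV: "open (U i)" "open (V i)" "U i \<inter> V i = {}" "u' i \<subseteq> U i" "v' i \<subseteq> V i" if "i \<in> N" for i
    using that by simp_all
  \<comment> \<open>The enlarged sets may meet the forbidden faces, so they are cut down by
    half-spaces.\<close>
  have "separating (\<lambda>t. t) N (\<lambda>i. U i \<inter> {t. t i < 1}) (\<lambda>i. V i \<inter> {t. 0 < t i})"
  proof (rule separatingI)
    fix i assume i: "i \<in> N"
    show "open (U i \<inter> {t. t i < 1})"
      by (rule open_Int[OF UV(1)[OF i] open_coordinate_halfspaces(1)])
    show "open (V i \<inter> {t. 0 < t i})"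
      by (rule open_Int[OF UV(2)[OF i] open_coordinate_halfspaces(2)])
    show "U i \<inter> {t. t i < 1} \<inter> (V i \<inter> {t. 0 < t i}) = {}"
      using UV(3)[OF i] by blast
  qed simp_all
  moreover have "{t. \<exists>!y. (t, y) \<in> Z} \<subseteq> (\<Union>i\<in>N. (U i \<inter> {t. t i < 1}) \<union> (V i \<inter> {t. 0 < t i}))"
  proof
    fix t assume "t \<in> {t. \<exists>!y. (t, y) \<in> Z}"
    then obtain y where y: "(t, y) \<in> Z" and un: "\<And>y'. (t, y') \<in> Z \<Longrightarrow> y' = y" by blast
    obtain i where i: "i \<in> N" "(t, y) \<in> u i \<union> v i" using cov y by blast
    have "t \<in> (U i \<inter> {t. t i < 1}) \<union> (V i \<inter> {t. 0 < t i})"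
    proof (cases "(t, y) \<in> u i")
      case True
      have "z \<in> u i" if "z \<in> Z" "fst z = t" for z
        using un[of "snd z"] that True by (cases z) simp
      then have "t \<in> u' i" using image_eqI[of t fst, OF _ y] unfolding u'_def by auto
      moreover have "t i < 1" using separatingD(4)[OF uv i(1) True] by simp
      ultimately show ?thesis using UV(4)[OF i(1)] by blast
    next
      case False
      with i have *: "(t, y) \<in> v i" by simp
      have "z \<in> v i" if "z \<in> Z" "fst z = t" for z
        using un[of "snd z"] that * by (cases z) simp
      then have "t \<in> v' i" using image_eqI[of t fst, OF _ y] unfolding v'_def by auto
      moreover have "0 < t i" using separatingD(5)[OF uv i(1) *] by simp
      ultimately show ?thesis using UV(5)[OF i(1)] by blast
    qed
    then show "t \<in> (\<Union>i\<in>N. (U i \<inter> {t. t i < 1}) \<union> (V i \<inter> {t. 0 < t i}))"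
      using i(1) by blast
  qed
  ultimately show "separates (\<lambda>t. t) N {t. \<exists>!y. (t, y) \<in> Z}"
    unfolding separates_def by (intro exI conjI)
qed

text \<open>Combines the preceding closure properties: such a cover would make the cube
  partitionable, in particular separated with all coordinates allowed.\<close>

lemma cube_not_covered_by_unique_sections:
  fixes Z :: "'j \<Rightarrow> ((nat \<Rightarrow> real) \<times> (nat \<Rightarrow> 'a::topological_space)) set"
  assumes "C_space (euclidean :: 'a topology)" "Hausdorff_space (euclidean :: 'a topology)"
    and "countable J" "\<And>j. j \<in> J \<Longrightarrow> compact (Z j)"
    and fibre: "\<And>j y. j \<in> J \<Longrightarrow> partitionable fst {z \<in> Z j. \<forall>l<n j. snd z l = y l}"
  shows "\<not> cube \<subseteq> (\<Union>j\<in>J. {t. \<exists>!y. (t, y) \<in> Z j})"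
proof
  assume cov: "cube \<subseteq> (\<Union>j\<in>J. {t. \<exists>!y. (t, y) \<in> Z j})"
  have c: "continuous_on UNIV (\<lambda>z :: (nat \<Rightarrow> real) \<times> (nat \<Rightarrow> 'a). snd z l)" for l
    by (rule continuous_on_product_then_coordinatewise[OF continuous_on_snd[OF continuous_on_id]])
  have "partitionable (\<lambda>t. t) {t. \<exists>!y. (t, y) \<in> Z j}" if "j \<in> J" for j
    using partitionable_joint_preimage[OF assms(1,2) c assms(4)[OF that] fibre[OF that]]
    by (rule partitionable_unique_section[OF assms(4)[OF that]])
  then have "partitionable (\<lambda>t. t) (\<Union>j\<in>J. {t. \<exists>!y. (t, y) \<in> Z j})"
    by (rule partitionable_UN_countable[OF assms(3) _ partitionable_empty])
  then have "partitionable (\<lambda>t. t) cube"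
    using cov by (rule partitionable_subset)
  then show False
    using not_separates_cube by (simp add: partitionable_def)
qed

section \<open>The weak and the pointwise topology\<close>

text \<open>The type \<open>'a\<close> has only a topology; this ties a metric directly to its
  \<open>open\<close> predicate.\<close>

definition metrized_by :: "('a::topological_space \<Rightarrow> 'a \<Rightarrow> real) \<Rightarrow> bool" where
  "metrized_by d \<longleftrightarrow> Metric_space UNIV d \<and>
     (\<forall>U. open U \<longleftrightarrow> (\<forall>x\<in>U. \<exists>r>0. \<forall>y. d x y < r \<longrightarrow> y \<in> U))"

lemma metrized_byD:
  assumes "metrized_by d"
  shows "\<And>x y. d x y = 0 \<longleftrightarrow> x = y" "\<And>x y. 0 \<le> d x y" "\<And>x y. d x y = d y x"
    "\<And>x y z. d x z \<le> d x y + d y z"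
    "\<And>U. open U \<longleftrightarrow> (\<forall>x\<in>U. \<exists>r>0. \<forall>y. d x y < r \<longrightarrow> y \<in> U)"
  using assms unfolding metrized_by_def Metric_space_def by simp_all

lemma metrizable_euclidean_metrized_by:
  assumes "metrizable_space (euclidean :: 'a::topological_space topology)"
  shows "\<exists>d :: 'a \<Rightarrow> 'a \<Rightarrow> real. metrized_by d"
proof -
  obtain M and d :: "'a \<Rightarrow> 'a \<Rightarrow> real" where m: "Metric_space M d" and top: "euclidean = Metric_space.mtopology M d"
    using assms unfolding metrizable_space_def by blast
  interpret Metric_space M d by fact
  have M: "M = UNIV"
    using topspace_mtopology unfolding top[symmetric] by simp
  have ball: "mball x r = {y. d x y < r}" for x r
    unfolding mball_def using M by simp
  have "open U \<longleftrightarrow> (\<forall>x\<in>U. \<exists>r>0. \<forall>y. d x y < r \<longrightarrow> y \<in> U)" for U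
  proof -
    have "open U \<longleftrightarrow> (\<forall>x. x \<in> U \<longrightarrow> (\<exists>r>0. {y. d x y < r} \<subseteq> U))"
      using openin_mtopology[of U] unfolding top[symmetric] ball by (simp add: M)
    then show ?thesis by (simp add: subset_iff Ball_def)
  qed
  then show ?thesis
    using m unfolding metrized_by_def M by blast
qed

lemma continuous_dist_point:
  assumes "metrized_by d"
  shows "continuous_on UNIV (d p)"
proof (rule continuous_on_open_vimage[THEN iffD2, OF open_UNIV, rule_format])
  fix B :: "real set" assume "open B"
  have "\<exists>r>0. \<forall>y. d x y < r \<longrightarrow> d p y \<in> B" if x: "d p x \<in> B" for x
  proof -
    obtain e where e: "0 < e" "ball (d p x) e \<subseteq> B"
      using \<open>open B\<close> x open_contains_ball by blast
    have "d p y \<in> B" if "d x y < e" for y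
    proof -
      have "\<bar>d p x - d p y\<bar> \<le> d x y"
        using metrized_byD(4)[OF assms, of p x y] metrized_byD(4)[OF assms, of p y x]
          metrized_byD(3)[OF assms, of x y] by linarith
      then have "d p y \<in> ball (d p x) e" using that by (simp add: dist_real_def)
      then show ?thesis using e(2) by blast
    qed
    then show ?thesis using e(1) by blast
  qed
  then have "open (d p -` B)" by (subst metrized_byD(5)[OF assms]) simp
  then show "open (d p -` B \<inter> UNIV)" by simp
qed

text \<open>Takes closed balls of radius \<open>1 / real (Suc n)\<close> around finite nets. The
  members are closed so that the relations later cut out by them stay compact.\<close>

lemma countable_closed_network:
  assumes "compact_space (euclidean :: 'a::topological_space topology)"
    and "metrizable_space (euclidean :: 'a topology)"
  obtains \<B> :: "'a::topological_space set set" where "countable \<B>" "\<And>C. C \<in> \<B> \<Longrightarrow> closed C"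
    "\<And>U x. open U \<Longrightarrow> x \<in> U \<Longrightarrow> \<exists>C\<in>\<B>. x \<in> C \<and> C \<subseteq> U"
proof -
  obtain d :: "'a \<Rightarrow> 'a \<Rightarrow> real" where "metrized_by d"
    using metrizable_euclidean_metrized_by[OF assms(2)] by blast
  note d = metrized_byD[OF this] and cont = continuous_dist_point[OF this]
  have cpt: "compact (UNIV :: 'a set)"
    using assms(1) by (simp add: compact_space_def)
  have opb: "open {x. d p x < r}" for p r
    using cont by (intro open_Collect_less continuous_on_const)
  have "\<exists>F. finite F \<and> UNIV = (\<Union>p\<in>F. {x. d p x < 1 / real (Suc n)})" for n
  proof -
    have "x \<in> {y. d x y < 1 / real (Suc n)}" for x using d(1)[of x x] by simp
    then have "UNIV \<subseteq> (\<Union>p\<in>UNIV. {x. d p x < 1 / real (Suc n)})" by blast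
    then show ?thesis
      by (rule compactE_image[OF cpt opb]) (intro exI conjI equalityI subset_UNIV)
  qed
  then have "\<exists>F. \<forall>n. finite (F n) \<and> UNIV = (\<Union>p\<in>F n. {x. d p x < 1 / real (Suc n)})"
    by (intro choice allI)
  then obtain F where "\<forall>n. finite (F n) \<and> UNIV = (\<Union>p\<in>F n. {x. d p x < 1 / real (Suc n)})"
    by (rule exE)
  then have F: "\<And>n. finite (F n)" "\<And>n. UNIV = (\<Union>p\<in>F n. {x. d p x < 1 / real (Suc n)})"
    by simp_all
  define \<B> where "\<B> = (\<Union>n. (\<lambda>p. {x. d p x \<le> 1 / real (Suc n)}) ` F n)"
  show ?thesis
  proof (rule that[of \<B>])
    show "countable \<B>"
      unfolding \<B>_def by (intro countable_UN countableI_type countable_image countable_finite F(1))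
    show "closed C" if "C \<in> \<B>" for C
      using that cont by (auto simp: \<B>_def intro!: closed_Collect_le continuous_on_const)
    fix U and x :: 'a assume U: "open U" "x \<in> U"
    then obtain r where r: "r > 0" "\<And>y. d x y < r \<Longrightarrow> y \<in> U" using d(5) by blast
    obtain n where n: "1 / real (Suc n) < r / 2"
      using reals_Archimedean[of "r/2"] r(1) by (auto simp: inverse_eq_divide)
    obtain p where p: "p \<in> F n" "d p x < 1 / real (Suc n)" using F(2)[of n] by blast
    have "{y. d p y \<le> 1 / real (Suc n)} \<subseteq> U"
    proof clarify
      fix y assume "d p y \<le> 1 / real (Suc n)"
      then have "d x y < r" using d(4)[of x y p] d(3)[of x p] p(2) n by linarith
      then show "y \<in> U" by (rule r(2))
    qed
    moreover have "{y. d p y \<le> 1 / real (Suc n)} \<in> \<B>" using p(1) unfolding \<B>_def by blast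
    ultimately show "\<exists>C\<in>\<B>. x \<in> C \<and> C \<subseteq> U" using p(2) by (intro bexI conjI) auto
  qed
qed

text \<open>An infinite compact space has a non-isolated point \<open>p\<close>. The
  \<open>x n\<close> approach it with distances more than halved at each step, and the bumps are
  functions of the distance to \<open>p\<close>.\<close>

lemma biorthogonal_bumps:
  assumes "compact_space (euclidean :: 'a::topological_space topology)"
    and "metrizable_space (euclidean :: 'a topology)" "infinite (UNIV :: 'a set)"
  obtains x :: "nat \<Rightarrow> 'a::topological_space" and h :: "nat \<Rightarrow> ('a \<Rightarrow>\<^sub>C real)"
  where "\<And>i j. apply_bcontfun (h i) (x j) = (if i = j then 1 else 0)"
proof -
  obtain d :: "'a \<Rightarrow> 'a \<Rightarrow> real" where "metrized_by d"
    using metrizable_euclidean_metrized_by[OF assms(2)] by blast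
  note d = metrized_byD[OF this] and cont = continuous_dist_point[OF this]
  have cpt: "compact (UNIV :: 'a set)"
    using assms(1) by (simp add: compact_space_def)
  have "\<exists>p :: 'a. \<not> open {p}"
  proof (rule ccontr)
    assume "\<not> (\<exists>p :: 'a. \<not> open {p})"
    then have o: "open {p}" for p :: 'a by blast
    have "UNIV \<subseteq> (\<Union>p :: 'a. {p})" by blast
    then obtain F :: "'a set" where F: "finite F" "UNIV \<subseteq> (\<Union>p\<in>F. {p})"
      by (rule compactE_image[of UNIV UNIV "\<lambda>p. {p}", OF cpt o])
    then have "UNIV = F" by auto
    with F(1) assms(3) show False by simp
  qed
  then obtain p :: 'a where p: "\<not> open {p}" by blast
  have small: "\<exists>y. 0 < d p y \<and> d p y < r" if "0 < r" for r
  proof -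
    have "\<forall>r>0. \<exists>y. d p y < r \<and> y \<noteq> p" using p unfolding d(5)[of "{p}"] by simp
    then obtain y where "d p y < r" "y \<noteq> p" using \<open>0 < r\<close> by blast
    moreover have "d p y \<noteq> 0" using \<open>y \<noteq> p\<close> d(1)[of p y] by simp
    ultimately show ?thesis using d(2)[of p y] by (intro exI[of _ y]) linarith
  qed
  have "\<exists>x. \<forall>n. 0 < d p (x n) \<and> d p (x (Suc n)) < d p (x n) / 2"
  proof (rule dependent_nat_choice)
    show "\<exists>y. 0 < d p y" using small[of 1] by auto
    show "\<exists>z. 0 < d p z \<and> d p z < d p y / 2" if "0 < d p y" for y
      using small[of "d p y / 2"] that by simp
  qed
  then obtain x where x: "\<And>n. 0 < d p (x n)" "\<And>n. d p (x (Suc n)) < d p (x n) / 2" by blast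
  have dec: "d p (x j) < d p (x i) / 2" if "i < j" for i j
    using that
  proof (induction j)
    case (Suc j)
    show ?case
    proof (cases "i = j")
      case False
      then have "d p (x j) < d p (x i) / 2" using Suc by simp
      then show ?thesis using x(2)[of j] x(1)[of j] by linarith
    qed (use x(2) in simp)
  qed simp
  \<comment> \<open>The factor 2 makes \<open>g i\<close> vanish wherever the distance to
    \<open>p\<close> differs from that of \<open>x i\<close> by at least half of the latter, thus at
    all other \<open>x j\<close>.\<close>
  define g where "g i y = max 0 (1 - 2 * \<bar>d p y - d p (x i)\<bar> / d p (x i))" for i y
  have gc: "continuous_on UNIV (g i)" for i
    unfolding g_def[abs_def] using x(1)[of i]
    by (intro continuous_intros cont) auto
  have gb: "g i \<in> bcontfun" for i
    using continuous_in_bcontfun_if_compact[OF cpt gc] .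
  have "g i (x j) = (if i = j then 1 else 0)" for i j
  proof -
    consider "i = j" | "i < j" | "j < i" by linarith
    then show ?thesis
    proof cases
      case 2
      then have "1 \<le> 2 * \<bar>d p (x j) - d p (x i)\<bar> / d p (x i)"
        using dec[of i j] x(1)[of i] by (simp add: le_divide_eq)
      then show ?thesis using 2 by (simp add: g_def)
    next
      case 3
      then have "1 \<le> 2 * \<bar>d p (x j) - d p (x i)\<bar> / d p (x i)"
        using dec[of j i] x(1)[of i] by (simp add: le_divide_eq)
      then show ?thesis using 3 by (simp add: g_def)
    qed (simp add: g_def)
  qed
  then show ?thesis
    by (intro that[of "\<lambda>i. Bcontfun (g i)" x]) (simp add: Bcontfun_inverse[OF gb])
qed

lemma finite_interpolation:
  fixes c :: "'a::topological_space \<Rightarrow> real"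
  assumes "compact_space (euclidean :: 'a topology)" "metrizable_space (euclidean :: 'a topology)" "finite E"
  obtains g :: "'a \<Rightarrow>\<^sub>C real" where "\<forall>x\<in>E. apply_bcontfun g x = c x"
proof -
  have t1: "t1_space (euclidean :: 'a topology)"
    using assms(2) by (rule metrizable_imp_t1_space)
  then have clF: "closedin (euclidean :: 'a topology) F" if "finite F" for F
    using that by (auto simp: t1_space_closedin_finite)
  \<comment> \<open>A finite subset is discrete, so any \<open>c\<close> is continuous on it and
    Tietze's theorem applies.\<close>
  have "subtopology euclidean E = discrete_topology E"
    using t1 assms(3) unfolding t1_space_derived_set_of_finite by (simp add: subtopology_eq_discrete_topology_eq)
  then have "continuous_map (subtopology euclidean E) euclideanreal c" by simp
  then obtain g where g: "continuous_map (euclidean :: 'a topology) euclideanreal g" "\<And>x. x \<in> E \<Longrightarrow> g x = c x"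
    using Tietze_extension_realinterval[OF metrizable_imp_normal_space[OF assms(2)] clF[OF assms(3)], of UNIV c]
    by auto
  have "g \<in> bcontfun"
    using assms(1) g(1) by (intro continuous_in_bcontfun_if_compact) (auto simp: compact_space_def)
  then show ?thesis
    using g(2) by (intro that[of "Bcontfun g"]) (simp add: Bcontfun_inverse)
qed

section \<open>Neighbourhoods in the two topologies\<close>

text \<open>Demanding equality instead of closeness yields an affine subspace of finite codimension
  inside the neighbourhood.\<close>

lemma weak_topology_neighbourhood:
  fixes V :: "'b::real_normed_vector set"
  assumes "openin weak_topology V" "v0 \<in> V"
  obtains S :: "('b \<Rightarrow>\<^sub>L real) set" where "finite S"
    "{v. \<forall>\<phi>\<in>S. blinfun_apply \<phi> v = blinfun_apply \<phi> v0} \<subseteq> V"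
proof -
  have "generate_topology_on {blinfun_apply \<phi> -` U |(\<phi> :: 'b \<Rightarrow>\<^sub>L real) U. open U} V"
    using assms(1) unfolding weak_topology_def by (rule openin_topology_generated_by)
  then have "\<exists>S :: ('b \<Rightarrow>\<^sub>L real) set. finite S \<and> {v. \<forall>\<phi>\<in>S. blinfun_apply \<phi> v = blinfun_apply \<phi> v0} \<subseteq> V"
    using assms(2)
  proof induction
    case (Int a b)
    then have "v0 \<in> a" "v0 \<in> b" by simp_all
    from Int.IH(1)[OF this(1)] obtain S :: "('b \<Rightarrow>\<^sub>L real) set"
      where "finite S" "{v. \<forall>\<phi>\<in>S. blinfun_apply \<phi> v = blinfun_apply \<phi> v0} \<subseteq> a"
      by blast
    moreover from Int.IH(2)[OF \<open>v0 \<in> b\<close>] obtain T :: "('b \<Rightarrow>\<^sub>L real) set"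
      where "finite T" "{v. \<forall>\<phi>\<in>T. blinfun_apply \<phi> v = blinfun_apply \<phi> v0} \<subseteq> b"
      by blast
    ultimately show ?case by (intro exI[of _ "S \<union> T"]) (simp add: ball_Un Collect_conj_eq le_infI1 le_infI2)
  next
    case (UN K)
    then obtain k where k: "k \<in> K" "v0 \<in> k" by blast
    from UN.IH[OF this] obtain S :: "('b \<Rightarrow>\<^sub>L real) set"
      where "finite S" "{v. \<forall>\<phi>\<in>S. blinfun_apply \<phi> v = blinfun_apply \<phi> v0} \<subseteq> k"
      by blast
    then have "finite S \<and> {v. \<forall>\<phi>\<in>S. blinfun_apply \<phi> v = blinfun_apply \<phi> v0} \<subseteq> \<Union>K"
      using k(1) by (simp add: le_supI Sup_upper subset_trans[OF _ Sup_upper])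
    then show ?case by (rule exI)
  next
    case (Basis s)
    then obtain \<phi> :: "'b \<Rightarrow>\<^sub>L real" and U where "s = blinfun_apply \<phi> -` U" by blast
    then show ?case using Basis.prems by (intro exI[of _ "{\<phi>}"]) auto
  qed simp
  then show ?thesis using that by blast
qed

lemma openin_weak_topology_functional:
  fixes \<phi> :: "'b::real_normed_vector \<Rightarrow>\<^sub>L real"
  assumes "open U"
  shows "openin weak_topology {v. blinfun_apply \<phi> v \<in> U}"
proof -
  have "blinfun_apply \<phi> -` U \<in> {blinfun_apply \<phi> -` U |(\<phi> :: 'b \<Rightarrow>\<^sub>L real) U. open U}"
    using assms by (intro CollectI exI[of _ \<phi>] exI[of _ U] conjI refl)
  then show ?thesis
    unfolding weak_topology_def vimage_def by (rule topology_generated_by_Basis)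
qed

lemma pointwise_topology_neighbourhood:
  fixes V :: "('a::topological_space \<Rightarrow>\<^sub>C real) set"
  assumes "openin pointwise_topology V" "h \<in> V"
  obtains E e where "finite E" "e > 0"
    "{g. \<forall>x\<in>E. \<bar>apply_bcontfun g x - apply_bcontfun h x\<bar> < e} \<subseteq> V"
proof -
  obtain W where W: "openin (powertop_real UNIV) W" "V = apply_bcontfun -` W"
    using assms(1) unfolding pointwise_topology_def openin_pullback_topology by auto
  then have "apply_bcontfun h \<in> W" using assms(2) by simp
  then obtain U where U: "finite {i. U i \<noteq> (UNIV :: real set)}" "\<And>i. open (U i)"
    "apply_bcontfun h \<in> Pi\<^sub>E UNIV U" "Pi\<^sub>E UNIV U \<subseteq> W"
    using W(1) unfolding openin_product_topology_alt by auto
  let ?E = "{i. U i \<noteq> (UNIV :: real set)}"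
  have "\<exists>e>0. ball (apply_bcontfun h x) e \<subseteq> U x" for x
    using U(2)[of x] PiE_mem[OF U(3) UNIV_I] unfolding open_contains_ball by blast
  then obtain r where r: "\<And>x. r x > 0" "\<And>x. ball (apply_bcontfun h x) (r x) \<subseteq> U x" by metis
  \<comment> \<open>The 1 covers the case that no coordinate is restricted.\<close>
  define e where "e = Min (insert 1 (r ` ?E))"
  have e: "e > 0" "\<And>x. x \<in> ?E \<Longrightarrow> e \<le> r x"
    unfolding e_def using U(1) r(1) by auto
  show ?thesis
  proof (rule that[OF U(1) e(1)], rule subsetI)
    fix g assume "g \<in> {g. \<forall>x\<in>?E. \<bar>apply_bcontfun g x - apply_bcontfun h x\<bar> < e}"
    then have g: "\<bar>apply_bcontfun g x - apply_bcontfun h x\<bar> < e" if "x \<in> ?E" for x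
      using that by blast
    have "apply_bcontfun g x \<in> U x" for x
    proof (cases "x \<in> ?E")
      case True
      then have "apply_bcontfun g x \<in> ball (apply_bcontfun h x) (r x)"
        using g[OF True] e(2)[OF True] by (simp add: dist_real_def abs_minus_commute)
      then show ?thesis using r(2) by blast
    qed simp
    then have "apply_bcontfun g \<in> W" using U(4) by blast
    then show "g \<in> V" using W(2) by simp
  qed
qed

lemma openin_pointwise_topology_finite:
  "openin pointwise_topology {h. \<forall>l<(n::nat). \<bar>apply_bcontfun h (y l)\<bar> < (e :: real)}"
proof -
  have "open {f. \<forall>l\<in>{..<n}. f (y l) \<in> {-e<..<e}}"
    using product_topology_basis'[of "{..<n}" "\<lambda>_. {-e<..<e}" y] by simp
  then have "openin (powertop_real UNIV) {f. \<forall>l\<in>{..<n}. f (y l) \<in> {-e<..<e}}"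
    by (simp add: euclidean_product_topology)
  then show ?thesis
    unfolding pointwise_topology_def openin_pullback_topology
    by (intro exI[of _ "{f. \<forall>l\<in>{..<n}. f (y l) \<in> {-e<..<e}}"] conjI) (auto simp: abs_less_iff minus_less_iff)
qed

text \<open>Gaussian elimination: the equation of \<open>\<psi>\<close> is solved for the unknown
  with index \<open>j\<close>, and the result is substituted into the other equations.\<close>

lemma underdetermined_system:
  fixes F :: "'s \<Rightarrow> 'i \<Rightarrow> real"
  assumes "finite S" "finite I" "card S < card I"
  shows "\<exists>b. (\<exists>i\<in>I. b i \<noteq> 0) \<and> (\<forall>\<phi>\<in>S. (\<Sum>i\<in>I. b i * F \<phi> i) = 0)"
  using assms
proof (induction S arbitrary: I F rule: finite_induct)
  case empty
  then have "I \<noteq> {}" by auto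
  then show ?case by (intro exI[of _ "\<lambda>_. 1"]) auto
next
  case (insert \<psi> S)
  show ?case
  proof (cases "\<forall>i\<in>I. F \<psi> i = 0")
    case True
    have "card S < card I" using insert by simp
    from insert.IH[OF insert.prems(1) this, of F]
    obtain b where "\<exists>i\<in>I. b i \<noteq> 0" "\<forall>\<phi>\<in>S. (\<Sum>i\<in>I. b i * F \<phi> i) = 0" by blast
    then show ?thesis using True by (intro exI[of _ b]) simp
  next
    case False
    then obtain j where j: "j \<in> I" "F \<psi> j \<noteq> 0" by blast
    have fin: "finite (I - {j})" and "card S < card (I - {j})" using insert j by simp_all
    from insert.IH[OF this, of "\<lambda>\<phi> i. F \<phi> i - F \<phi> j * F \<psi> i / F \<psi> j"]
    obtain b where b: "\<exists>i\<in>I - {j}. b i \<noteq> 0"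
      "\<forall>\<phi>\<in>S. (\<Sum>i\<in>I - {j}. b i * (F \<phi> i - F \<phi> j * F \<psi> i / F \<psi> j)) = 0"
      by blast
    define s where "s = - (\<Sum>i\<in>I - {j}. b i * F \<psi> i) / F \<psi> j"
    have sum: "(\<Sum>i\<in>I. (b(j := s)) i * F \<phi> i) = s * F \<phi> j + (\<Sum>i\<in>I - {j}. b i * F \<phi> i)" for \<phi>
      using insert.prems(1) j(1) by (subst sum.remove[of I j]) (auto intro: sum.cong)
    have "(\<Sum>i\<in>I. (b(j := s)) i * F \<phi> i) = 0" if "\<phi> \<in> insert \<psi> S" for \<phi>
    proof (cases "\<phi> = \<psi>")
      case True
      then show ?thesis unfolding sum using j(2) by (simp add: s_def)
    next
      case False
      have "0 = (\<Sum>i\<in>I - {j}. b i * (F \<phi> i - F \<phi> j * F \<psi> i / F \<psi> j))"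
        using b(2) that False by simp
      also have "\<dots> = (\<Sum>i\<in>I - {j}. b i * F \<phi> i) - F \<phi> j / F \<psi> j * (\<Sum>i\<in>I - {j}. b i * F \<psi> i)"
        unfolding sum_distrib_left sum_subtractf[symmetric]
        by (rule sum.cong) (simp_all add: right_diff_distrib)
      also have "F \<phi> j / F \<psi> j * (\<Sum>i\<in>I - {j}. b i * F \<psi> i) = - (s * F \<phi> j)"
        by (simp add: s_def)
      finally show ?thesis unfolding sum by simp
    qed
    moreover have "\<exists>i\<in>I. (b(j := s)) i \<noteq> 0" using b(1) by auto
    ultimately show ?thesis by (intro exI[of _ "b(j := s)"]) simp
  qed
qed

section \<open>Supports of functionals\<close>

text \<open>The coordinates of \<open>t\<close> are clamped to \<open>[0, 1]\<close> so that the series converges for every \<open>t\<close>.\<close>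

definition weighted_evaluation :: "(nat \<Rightarrow> 'a::topological_space) \<Rightarrow> (nat \<Rightarrow> real) \<Rightarrow> ('a \<Rightarrow>\<^sub>C real) \<Rightarrow>\<^sub>L real" where
  "weighted_evaluation x t = Blinfun (\<lambda>g. \<Sum>i. (1/2)^i * max 0 (min 1 (t i)) * apply_bcontfun g (x i))"

text \<open>The bound is independent of \<open>s\<close> and \<open>y\<close>; it gives both
  boundedness of the functional and uniform convergence in \<open>t\<close>.\<close>

lemma weighted_evaluation_term_bound:
  "norm ((1/2)^i * max 0 (min 1 (s :: real)) * apply_bcontfun g y) \<le> (1/2)^i * norm (g :: 'a::topological_space \<Rightarrow>\<^sub>C real)"
proof -
  have "\<bar>max 0 (min 1 s)\<bar> * \<bar>apply_bcontfun g y\<bar> \<le> 1 * norm g"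
    using norm_bounded[of g y] by (intro mult_mono) auto
  then show ?thesis
    by (simp add: abs_mult mult.assoc)
qed

lemma summable_weighted_evaluation:
  fixes g :: "'a::topological_space \<Rightarrow>\<^sub>C real"
  shows "summable (\<lambda>i. (1/2)^i * max 0 (min 1 (t i :: real)) * apply_bcontfun g (x i))"
proof (rule summable_comparison_test')
  show "summable (\<lambda>i. (1/2)^i * norm g)"
    by (intro summable_mult2 summable_geometric) simp
qed (rule weighted_evaluation_term_bound)

lemma weighted_evaluation_apply:
  fixes g :: "'a::topological_space \<Rightarrow>\<^sub>C real"
  shows "blinfun_apply (weighted_evaluation x t) g =
    (\<Sum>i. (1/2)^i * max 0 (min 1 (t i)) * apply_bcontfun g (x i))"
proof -
  have "bounded_linear (\<lambda>g :: 'a \<Rightarrow>\<^sub>C real. \<Sum>i. (1/2)^i * max 0 (min 1 (t i)) * apply_bcontfun g (x i))"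
  proof (rule bounded_linear_intro)
    fix g g' :: "'a \<Rightarrow>\<^sub>C real" and r :: real
    show "(\<Sum>i. (1/2)^i * max 0 (min 1 (t i)) * apply_bcontfun (g + g') (x i)) =
        (\<Sum>i. (1/2)^i * max 0 (min 1 (t i)) * apply_bcontfun g (x i)) +
        (\<Sum>i. (1/2)^i * max 0 (min 1 (t i)) * apply_bcontfun g' (x i))"
      by (subst suminf_add[OF summable_weighted_evaluation summable_weighted_evaluation])
        (simp add: distrib_left)
    show "(\<Sum>i. (1/2)^i * max 0 (min 1 (t i)) * apply_bcontfun (r *\<^sub>R g) (x i)) =
        r *\<^sub>R (\<Sum>i. (1/2)^i * max 0 (min 1 (t i)) * apply_bcontfun g (x i))"
      unfolding real_scaleR_def
      by (subst suminf_mult[OF summable_weighted_evaluation, symmetric]) (simp add: mult.left_commute)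
    have s: "summable (\<lambda>i. (1/2)^i * norm g)"
      by (intro summable_mult2 summable_geometric) simp
    have "norm (\<Sum>i. (1/2)^i * max 0 (min 1 (t i)) * apply_bcontfun g (x i)) \<le> (\<Sum>i. (1/2)^i * norm g)"
      by (rule norm_suminf_le[OF weighted_evaluation_term_bound s])
    also have "\<dots> = norm g * 2"
      using suminf_mult2[OF summable_geometric, of "1/2 :: real" "norm g"] suminf_geometric[of "1/2 :: real"] by simp
    finally show "norm (\<Sum>i. (1/2)^i * max 0 (min 1 (t i)) * apply_bcontfun g (x i)) \<le> norm g * 2" .
  qed
  then show ?thesis
    unfolding weighted_evaluation_def by (simp add: bounded_linear_Blinfun_apply)
qed

lemma continuous_weighted_evaluation:
  fixes g :: "'a::topological_space \<Rightarrow>\<^sub>C real"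
  shows "continuous_on UNIV (\<lambda>t. blinfun_apply (weighted_evaluation x t) g)"
  unfolding weighted_evaluation_apply
proof (rule uniform_limit_theorem)
  show "uniform_limit UNIV (\<lambda>n t. \<Sum>i<n. (1/2)^i * max 0 (min 1 (t i)) * apply_bcontfun g (x i))
      (\<lambda>t. \<Sum>i. (1/2)^i * max 0 (min 1 (t i)) * apply_bcontfun g (x i)) sequentially"
  proof (rule Weierstrass_m_test)
    show "summable (\<lambda>i. (1/2)^i * norm g)"
      by (intro summable_mult2 summable_geometric) simp
  qed (rule weighted_evaluation_term_bound)
  show "\<forall>\<^sub>F n in sequentially. continuous_on UNIV
      (\<lambda>t :: nat \<Rightarrow> real. \<Sum>i<n. (1/2)^i * max 0 (min 1 (t i)) * apply_bcontfun g (x i))"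
    by (intro always_eventually allI continuous_on_sum continuous_on_mult continuous_on_max
        continuous_on_min continuous_on_const continuous_on_product_coordinates)
qed simp

text \<open>Turns the vanishing of the functional on a combination of bumps into a linear relation
  between the coordinates of \<open>t\<close>.\<close>

lemma weighted_evaluation_combination:
  fixes h :: "nat \<Rightarrow> 'a::topological_space \<Rightarrow>\<^sub>C real"
  assumes bi: "\<And>i j. apply_bcontfun (h i) (x j) = (if i = j then 1 else 0)" and t: "t \<in> cube"
  shows "blinfun_apply (weighted_evaluation x t) (\<Sum>i\<in>I. b i *\<^sub>R h i) = (\<Sum>i\<in>I. b i * (1/2)^i * t i)"
proof -
  have "blinfun_apply (weighted_evaluation x t) (h i) = (1/2)^i * t i" for i
  proof -
    have "(\<lambda>j. (1/2)^j * max 0 (min 1 (t j)) * apply_bcontfun (h i) (x j)) =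
        (\<lambda>j. if j = i then (1/2)^i * t i else 0)"
      using t unfolding mem_cube bi by auto
    then show ?thesis
      unfolding weighted_evaluation_apply
      using sums_unique[OF sums_single[of i "\<lambda>_. (1/2)^i * t i"]] by simp
  qed
  then show ?thesis
    by (simp add: blinfun.sum_right blinfun.scaleR_right mult.assoc)
qed

text \<open>Tuples of all lengths are encoded as sequences of which only the first \<open>n\<close>
  entries matter. The bounds form a countable family indexed by \<open>m\<close>.\<close>

definition supports :: "nat \<Rightarrow> ('a::topological_space \<Rightarrow>\<^sub>C real) set \<Rightarrow> nat \<Rightarrow> (nat \<Rightarrow> 'a) \<Rightarrow> bool" where
  "supports m A n y \<longleftrightarrow> (\<forall>h. (\<forall>l<n. \<bar>apply_bcontfun h (y l)\<bar> < 1 / real (Suc m)) \<longrightarrow> h \<in> A)"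

lemma supports_mono: "supports m A n y \<Longrightarrow> A \<subseteq> B \<Longrightarrow> supports m B n y"
  unfolding supports_def by blast

lemma ex_support:
  fixes V :: "('a::topological_space \<Rightarrow>\<^sub>C real) set"
  assumes "openin pointwise_topology V" "0 \<in> V"
  shows "\<exists>n m y. supports m V n y"
proof -
  obtain E e where E: "finite E" "e > 0"
    "{g. \<forall>x\<in>E. \<bar>apply_bcontfun g x - apply_bcontfun 0 x\<bar> < e} \<subseteq> V"
    by (rule pointwise_topology_neighbourhood[OF assms])
  obtain xs where xs: "set xs = E" using finite_list[OF E(1)] by blast
  obtain m where m: "1 / real (Suc m) < e"
    using reals_Archimedean[OF E(2)] by (auto simp: inverse_eq_divide)
  have "supports m V (length xs) (\<lambda>l. xs ! l)"
    unfolding supports_def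
  proof (intro allI impI)
    fix h assume h: "\<forall>l<length xs. \<bar>apply_bcontfun h (xs ! l)\<bar> < 1 / real (Suc m)"
    have "\<bar>apply_bcontfun h x\<bar> < e" if "x \<in> E" for x
    proof -
      obtain l where "l < length xs" "x = xs ! l" using xs \<open>x \<in> E\<close> by (metis in_set_conv_nth)
      with h have "\<bar>apply_bcontfun h x\<bar> < 1 / real (Suc m)" by simp
      with m show ?thesis by simp
    qed
    then have "h \<in> {g. \<forall>x\<in>E. \<bar>apply_bcontfun g x - apply_bcontfun 0 x\<bar> < e}" by simp
    then show "h \<in> V" using E(3) by (rule set_mp[rotated])
  qed
  then show ?thesis by blast
qed

text \<open>
  If another supporting tuple \<open>y'\<close> is close to \<open>y\<close>, a function that is small only at the common entries
  can be changed to be zero at the remaining entries of \<open>y'\<close> without affecting any point of a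
  prescribed finite set. So the common entries alone would already support \<open>A\<close>.
\<close>

lemma isolated_support:
  fixes A :: "('a::topological_space \<Rightarrow>\<^sub>C real) set"
  assumes cpt: "compact_space (euclidean :: 'a topology)" and metr: "metrizable_space (euclidean :: 'a topology)"
    and A: "openin pointwise_topology (- A)"
    and min: "\<forall>k<n. \<forall>y'. \<not> supports m A k y'"
  shows "\<exists>U. (\<forall>l. open (U l) \<and> y l \<in> U l) \<and>
    (\<forall>y'. supports m A n y' \<longrightarrow> (\<forall>l<n. y' l \<in> U l) \<longrightarrow> (\<forall>l<n. y' l = y l))"
proof -
  \<comment> \<open>For fewer than \<open>n\<close> indices minimality gives a function outside
    \<open>A\<close> that is small at the chosen entries. As \<open>- A\<close> is open, its values
    on a finite set \<open>E\<close> suffice to keep it outside \<open>A\<close>.\<close>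
  have "\<exists>h E. finite E \<and> (\<forall>l\<in>L. \<bar>apply_bcontfun h (y l)\<bar> < 1 / real (Suc m)) \<and>
      (\<forall>g. (\<forall>x\<in>E. apply_bcontfun g x = apply_bcontfun h x) \<longrightarrow> g \<notin> A)" if "L \<subset> {..<n}" for L
  proof -
    have "finite L" using that finite_subset by blast
    then obtain e where e: "bij_betw e {0..<card L} L" using ex_bij_betw_nat_finite by blast
    have "card L < n" using psubset_card_mono[OF finite_lessThan that] by simp
    then have "\<not> supports m A (card L) (\<lambda>i. y (e i))" using min by simp
    then obtain h where
      h: "\<forall>i<card L. \<bar>apply_bcontfun h (y (e i))\<bar> < 1 / real (Suc m)" "h \<notin> A"
      unfolding supports_def by blast
    have "h \<in> - A" using h(2) by simp
    with A obtain E d where E: "finite E" "d > 0"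
      "{g. \<forall>x\<in>E. \<bar>apply_bcontfun g x - apply_bcontfun h x\<bar> < d} \<subseteq> - A"
      by (rule pointwise_topology_neighbourhood)
    have "\<bar>apply_bcontfun h (y l)\<bar> < 1 / real (Suc m)" if l: "l \<in> L" for l
    proof -
      have "l \<in> e ` {0..<card L}" using l e by (simp add: bij_betw_def)
      then obtain i where "i < card L" "l = e i" by auto
      then show ?thesis using h(1) by simp
    qed
    moreover have "g \<notin> A" if "\<forall>x\<in>E. apply_bcontfun g x = apply_bcontfun h x" for g
    proof -
      have "g \<in> {g. \<forall>x\<in>E. \<bar>apply_bcontfun g x - apply_bcontfun h x\<bar> < d}" using E(2) that by simp
      then show ?thesis using E(3) by blast
    qed
    ultimately show ?thesis using E(1) by (intro exI[of _ h] exI[of _ E]) simp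
  qed
  then have "\<forall>L\<in>{L. L \<subset> {..<n}}. \<exists>h E. finite E \<and> (\<forall>l\<in>L. \<bar>apply_bcontfun h (y l)\<bar> < 1 / real (Suc m)) \<and>
      (\<forall>g. (\<forall>x\<in>E. apply_bcontfun g x = apply_bcontfun h x) \<longrightarrow> g \<notin> A)" by simp
  then have "\<exists>h. \<forall>L\<in>{L. L \<subset> {..<n}}. \<exists>E. finite E \<and> (\<forall>l\<in>L. \<bar>apply_bcontfun (h L) (y l)\<bar> < 1 / real (Suc m)) \<and>
      (\<forall>g. (\<forall>x\<in>E. apply_bcontfun g x = apply_bcontfun (h L) x) \<longrightarrow> g \<notin> A)" by (rule bchoice)
  then obtain h where "\<forall>L\<in>{L. L \<subset> {..<n}}. \<exists>E. finite E \<and> (\<forall>l\<in>L. \<bar>apply_bcontfun (h L) (y l)\<bar> < 1 / real (Suc m)) \<and>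
      (\<forall>g. (\<forall>x\<in>E. apply_bcontfun g x = apply_bcontfun (h L) x) \<longrightarrow> g \<notin> A)" by (rule exE)
  then have "\<exists>E. \<forall>L\<in>{L. L \<subset> {..<n}}. finite (E L) \<and> (\<forall>l\<in>L. \<bar>apply_bcontfun (h L) (y l)\<bar> < 1 / real (Suc m)) \<and>
      (\<forall>g. (\<forall>x\<in>E L. apply_bcontfun g x = apply_bcontfun (h L) x) \<longrightarrow> g \<notin> A)" by (rule bchoice)
  then obtain E where E: "\<forall>L\<in>{L. L \<subset> {..<n}}. finite (E L) \<and> (\<forall>l\<in>L. \<bar>apply_bcontfun (h L) (y l)\<bar> < 1 / real (Suc m)) \<and>
      (\<forall>g. (\<forall>x\<in>E L. apply_bcontfun g x = apply_bcontfun (h L) x) \<longrightarrow> g \<notin> A)" by (rule exE)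
  define D where "D = (\<Union>L\<in>{L. L \<subset> {..<n}}. E L) \<union> y ` {..<n}"
  have "finite {L. L \<subset> {..<n}}"
    by (rule finite_subset[of _ "Pow {..<n}"]) auto
  then have finD: "finite D" unfolding D_def using E by auto
  \<comment> \<open>A point of \<open>U l\<close> is either \<open>y l\<close> itself or outside
    \<open>D\<close>, where values can be prescribed freely.\<close>
  define U where "U l = - (D - {y l})" for l
  have t1: "t1_space (euclidean :: 'a topology)"
    using metr by (rule metrizable_imp_t1_space)
  have "closed F" if "finite F" for F :: "'a set"
    using t1 that unfolding t1_space_closedin_finite by simp
  then have "open (U l)" for l
    using finD unfolding U_def by (intro open_Compl) simp
  moreover have "y l \<in> U l" for l by (simp add: U_def)
  moreover have "y' l = y l" if y': "supports m A n y'" and U: "\<forall>l<n. y' l \<in> U l" and "l < n" for y' l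
  proof (rule ccontr)
    assume "y' l \<noteq> y l"
    define L where "L = {i. i < n \<and> y' i = y i}"
    have L: "L \<subset> {..<n}" using \<open>l < n\<close> \<open>y' l \<noteq> y l\<close> by (auto simp: L_def)
    have EL: "\<And>i. i \<in> L \<Longrightarrow> \<bar>apply_bcontfun (h L) (y i)\<bar> < 1 / real (Suc m)"
      "\<And>g. (\<forall>x\<in>E L. apply_bcontfun g x = apply_bcontfun (h L) x) \<Longrightarrow> g \<notin> A"
      using bspec[OF E, of L] L by simp_all
    have "finite (D \<union> y' ` {..<n})" using finD by simp
    \<comment> \<open>\<open>g\<close> imitates \<open>h L\<close> on \<open>D\<close> and is 0 at
      the entries of \<open>y'\<close> off \<open>D\<close>: it is small on all of \<open>y'\<close>
      and yet outside \<open>A\<close>.\<close>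
    then obtain g :: "'a \<Rightarrow>\<^sub>C real" where g: "\<forall>x\<in>D \<union> y' ` {..<n}.
        apply_bcontfun g x = (if x \<in> D then apply_bcontfun (h L) x else 0)"
      by (rule finite_interpolation[OF cpt metr])
    have "E L \<subseteq> D" using L by (auto simp: D_def)
    then have "\<forall>x\<in>E L. apply_bcontfun g x = apply_bcontfun (h L) x" using g by auto
    then have "g \<notin> A" by (rule EL(2))
    moreover have "\<bar>apply_bcontfun g (y' i)\<bar> < 1 / real (Suc m)" if "i < n" for i
    proof (cases "i \<in> L")
      case True
      then have "y' i = y i" "y' i \<in> D" using that by (auto simp: L_def D_def)
      then show ?thesis using EL(1)[OF True] bspec[OF g, of "y' i"] by simp
    next
      case False
      then have "y' i \<notin> D" using U that by (auto simp: L_def U_def)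
      then show ?thesis using bspec[OF g, of "y' i"] that by simp
    qed
    ultimately show False using y' by (simp add: supports_def)
  qed
  ultimately show ?thesis by (intro exI[of _ U]) simp
qed

section \<open>Supports relative to a homeomorphism\<close>

text \<open>The non-strict inequality makes the complement open, as isolation of supports requires,
  and makes supporting a closed condition. The value 1 is arbitrary.\<close>

definition bounded_displacement ::
    "(('a::topological_space \<Rightarrow>\<^sub>C real) \<Rightarrow> 'b::real_normed_vector) \<Rightarrow> ('b \<Rightarrow>\<^sub>L real) \<Rightarrow> ('a \<Rightarrow>\<^sub>C real) set" where
  "bounded_displacement \<Phi> \<mu> = {h. \<bar>blinfun_apply \<mu> (\<Phi> h) - blinfun_apply \<mu> (\<Phi> 0)\<bar> \<le> 1}"

lemma openin_displacement:
  fixes \<Phi> :: "('a::topological_space \<Rightarrow>\<^sub>C real) \<Rightarrow> 'b::real_normed_vector"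
    and c :: real
  assumes "continuous_map pointwise_topology weak_topology \<Phi>" "open U"
  shows "openin pointwise_topology {h. blinfun_apply \<mu> (\<Phi> h) - c \<in> U}"
proof -
  have "open ((\<lambda>r :: real. r - c) -` U)"
    using assms(2) by (intro open_vimage continuous_intros)
  from openin_continuous_map_preimage[OF assms(1) openin_weak_topology_functional[OF this, of \<mu>]]
  show ?thesis by simp
qed

lemma openin_Compl_bounded_displacement:
  fixes \<Phi> :: "('a::topological_space \<Rightarrow>\<^sub>C real) \<Rightarrow> 'b::real_normed_vector"
  assumes "continuous_map pointwise_topology weak_topology \<Phi>"
  shows "openin pointwise_topology (- bounded_displacement \<Phi> \<mu>)"
proof -
  have "open {r :: real. 1 < \<bar>r\<bar>}"
    by (intro open_Collect_less continuous_intros)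
  from openin_displacement[OF assms this] show ?thesis
    by (simp add: bounded_displacement_def Collect_neg_eq[symmetric] not_le)
qed

lemma ex_support_bounded_displacement:
  fixes \<Phi> :: "('a::topological_space \<Rightarrow>\<^sub>C real) \<Rightarrow> 'b::real_normed_vector"
  assumes "continuous_map pointwise_topology weak_topology \<Phi>"
  shows "\<exists>n m y. supports m (bounded_displacement \<Phi> \<mu>) n y"
proof -
  have "open {r :: real. \<bar>r\<bar> < 1}"
    by (intro open_Collect_less continuous_intros)
  from ex_support[OF openin_displacement[OF assms this, of \<mu> "blinfun_apply \<mu> (\<Phi> 0)"]]
  obtain n m y where "supports m {h. blinfun_apply \<mu> (\<Phi> h) - blinfun_apply \<mu> (\<Phi> 0) \<in> {r. \<bar>r\<bar> < 1}} n y"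
    by auto
  then have "supports m (bounded_displacement \<Phi> \<mu>) n y"
    by (rule supports_mono) (auto simp: bounded_displacement_def)
  then show ?thesis by blast
qed

text \<open>The image under \<open>\<Phi>\<close> of the basic neighbourhood given by
  \<open>y\<close> contains an affine subspace of finite codimension. A functional with bounded
  displacement there vanishes on its directions, which forces linear relations on \<open>t\<close>
  that depend only on \<open>y\<close>, \<open>m\<close> and \<open>n\<close>.\<close>

lemma partitionable_supports:
  fixes f \<Phi> :: "('a::topological_space \<Rightarrow>\<^sub>C real) \<Rightarrow> ('a \<Rightarrow>\<^sub>C real)"
    and h :: "nat \<Rightarrow> 'a \<Rightarrow>\<^sub>C real"
  assumes hom: "homeomorphic_maps weak_topology pointwise_topology f \<Phi>"
    and bi: "\<And>i j. apply_bcontfun (h i) (x j) = (if i = j then 1 else 0)"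
  shows "partitionable fst {z :: (nat \<Rightarrow> real) \<times> 'c::topological_space.
    fst z \<in> cube \<and> supports m (bounded_displacement \<Phi> (weighted_evaluation x (fst z))) n y}"
proof -
  let ?O = "{k. \<forall>l<n. \<bar>apply_bcontfun k (y l)\<bar> < 1 / real (Suc m)}"
  have cf: "continuous_map weak_topology pointwise_topology f" and inv: "\<And>v. \<Phi> (f v) = v" "\<And>v. f (\<Phi> v) = v"
    using hom by (simp_all add: homeomorphic_maps_def)
  have "openin weak_topology {v. f v \<in> ?O}"
    using openin_continuous_map_preimage[OF cf openin_pointwise_topology_finite] by simp
  moreover have "\<Phi> 0 \<in> {v. f v \<in> ?O}" by (simp add: inv)
  ultimately obtain S :: "(('a \<Rightarrow>\<^sub>C real) \<Rightarrow>\<^sub>L real) set" where S: "finite S"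
    "{v. \<forall>\<phi>\<in>S. blinfun_apply \<phi> v = blinfun_apply \<phi> (\<Phi> 0)} \<subseteq> {v. f v \<in> ?O}"
    by (rule weak_topology_neighbourhood)
  show ?thesis
  proof (rule partitionable_linear_relations)
    show "continuous_on UNIV (\<lambda>z :: (nat \<Rightarrow> real) \<times> 'c. fst z i)" for i
      by (rule continuous_on_product_then_coordinatewise[OF continuous_on_fst[OF continuous_on_id]])
    fix I :: "nat set" assume I: "finite I" "card S < card I"
    from underdetermined_system[OF S(1) I, of "\<lambda>\<phi> i. blinfun_apply \<phi> (h i)"]
    obtain b where b: "\<exists>i\<in>I. b i \<noteq> 0" "\<And>\<phi>. \<phi> \<in> S \<Longrightarrow> (\<Sum>i\<in>I. b i * blinfun_apply \<phi> (h i)) = 0"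
      by blast
    \<comment> \<open>A combination of bumps killed by all of \<open>S\<close>, so the whole line
      through \<open>\<Phi> 0\<close> in direction \<open>w\<close> stays in the
      neighbourhood.\<close>
    define w where "w = (\<Sum>i\<in>I. b i *\<^sub>R h i)"
    have w: "blinfun_apply \<phi> w = 0" if "\<phi> \<in> S" for \<phi>
      using b(2)[OF that] by (simp add: w_def blinfun.sum_right blinfun.scaleR_right)
    have fO: "f (\<Phi> 0 + r *\<^sub>R w) \<in> ?O" for r
    proof -
      have "\<Phi> 0 + r *\<^sub>R w \<in> {v. \<forall>\<phi>\<in>S. blinfun_apply \<phi> v = blinfun_apply \<phi> (\<Phi> 0)}"
        using w by (simp add: blinfun.add_right blinfun.scaleR_right)
      then show ?thesis using S(2) by blast
    qed
    have bd: "\<bar>blinfun_apply \<mu> (r *\<^sub>R w)\<bar> \<le> 1" if "supports m (bounded_displacement \<Phi> \<mu>) n y" for r \<mu>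
    proof -
      have "f (\<Phi> 0 + r *\<^sub>R w) \<in> bounded_displacement \<Phi> \<mu>"
        using that fO[of r] unfolding supports_def by blast
      then show ?thesis by (simp add: bounded_displacement_def inv blinfun.add_right)
    qed
    have "blinfun_apply \<mu> w = 0" if "supports m (bounded_displacement \<Phi> \<mu>) n y" for \<mu>
    proof (rule ccontr)
      assume "blinfun_apply \<mu> w \<noteq> 0"
      \<comment> \<open>A linear functional bounded on a line through 0 vanishes on it: this
        multiple of \<open>w\<close> would have value 2.\<close>
      then show False
        using bd[OF that, of "2 / blinfun_apply \<mu> w"] by (simp add: blinfun.scaleR_right)
    qed
    then have "(\<Sum>i\<in>I. b i * (1/2)^i * t i) = 0"
      if "t \<in> cube" "supports m (bounded_displacement \<Phi> (weighted_evaluation x t)) n y" for t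
      using that weighted_evaluation_combination[OF bi that(1), where b = b and I = I]
      unfolding w_def by simp
    then show "\<exists>a. (\<exists>i\<in>I. a i \<noteq> 0) \<and> (\<forall>z\<in>{z :: (nat \<Rightarrow> real) \<times> 'c. fst z \<in> cube \<and>
        supports m (bounded_displacement \<Phi> (weighted_evaluation x (fst z))) n y}. (\<Sum>i\<in>I. a i * fst z i) = 0)"
      using b(1) by (intro exI[of _ "\<lambda>i. b i * (1/2)^i"]) auto
  qed
qed

text \<open>For each \<open>h\<close>, either some entry has value at least the bound
  (\<open>P h\<close>) or the displacement is at most 1 (\<open>R h\<close>). Both conditions are
  closed in the pair of \<open>t\<close> and \<open>y\<close>, and so is their intersection over all
  \<open>h\<close>.\<close>

lemma closed_supports:
  fixes \<Phi> :: "('a::topological_space \<Rightarrow>\<^sub>C real) \<Rightarrow> ('a \<Rightarrow>\<^sub>C real)"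
  shows "closed {z. supports m (bounded_displacement \<Phi> (weighted_evaluation x (fst z))) n (snd z)}"
proof -
  have ev: "continuous_on UNIV (\<lambda>z :: (nat \<Rightarrow> real) \<times> (nat \<Rightarrow> 'a). apply_bcontfun h (snd z l))" for h :: "'a \<Rightarrow>\<^sub>C real" and l
    by (rule continuous_on_compose2[OF continuous_on_apply_bcontfun
          continuous_on_product_then_coordinatewise[OF continuous_on_snd[OF continuous_on_id]] subset_UNIV])
  have mu: "continuous_on UNIV (\<lambda>z :: (nat \<Rightarrow> real) \<times> (nat \<Rightarrow> 'a). blinfun_apply (weighted_evaluation x (fst z)) h)"
    for h :: "'a \<Rightarrow>\<^sub>C real"
    by (rule continuous_on_compose2[OF continuous_weighted_evaluation continuous_on_fst[OF continuous_on_id] subset_UNIV])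
  define P where "P h = (\<Union>l\<in>{..<n}. {z :: (nat \<Rightarrow> real) \<times> (nat \<Rightarrow> 'a).
      1 / real (Suc m) \<le> \<bar>apply_bcontfun h (snd z l)\<bar>})" for h :: "'a \<Rightarrow>\<^sub>C real"
  define R where "R h = {z :: (nat \<Rightarrow> real) \<times> (nat \<Rightarrow> 'a).
      \<bar>blinfun_apply (weighted_evaluation x (fst z)) (\<Phi> h) - blinfun_apply (weighted_evaluation x (fst z)) (\<Phi> 0)\<bar> \<le> 1}"
    for h
  have "closed (P h)" for h
    unfolding P_def by (intro closed_UN finite_lessThan ballI closed_Collect_le continuous_on_const continuous_on_rabs ev)
  moreover have "closed (R h)" for h
    unfolding R_def by (intro closed_Collect_le continuous_on_const continuous_on_rabs continuous_on_diff mu)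
  ultimately have "closed (\<Inter>h. P h \<union> R h)"
    by (intro closed_INT ballI closed_Un)
  moreover have "{z. supports m (bounded_displacement \<Phi> (weighted_evaluation x (fst z))) n (snd z)} = (\<Inter>h. P h \<union> R h)"
    unfolding supports_def bounded_displacement_def P_def R_def
    by (rule set_eqI) (simp add: not_less imp_conv_disj Bex_def not_le)
  ultimately show ?thesis by simp
qed

section \<open>Contradiction from a homeomorphism\<close>

theorem corollary1:
  assumes "compact_space (euclidean :: 'a::topological_space topology)"
    and "metrizable_space (euclidean :: 'a topology)"
    and "uncountable (UNIV :: 'a set)"
    and "C_space (euclidean :: 'a topology)"
  shows "\<not> (weak_topology :: ('a \<Rightarrow>\<^sub>C real) topology) homeomorphic_space
             (pointwise_topology :: ('a \<Rightarrow>\<^sub>C real) topology)"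
proof
  assume "(weak_topology :: ('a \<Rightarrow>\<^sub>C real) topology) homeomorphic_space
             (pointwise_topology :: ('a \<Rightarrow>\<^sub>C real) topology)"
  then obtain f \<Phi> :: "('a \<Rightarrow>\<^sub>C real) \<Rightarrow> ('a \<Rightarrow>\<^sub>C real)" where hom: "homeomorphic_maps weak_topology pointwise_topology f \<Phi>"
    unfolding homeomorphic_space_def by blast
  then have cont: "continuous_map pointwise_topology weak_topology \<Phi>"
    by (simp add: homeomorphic_maps_def)
  have "infinite (UNIV :: 'a set)"
    using assms(3) countable_finite by blast
  then obtain x :: "nat \<Rightarrow> 'a" and h :: "nat \<Rightarrow> ('a \<Rightarrow>\<^sub>C real)"
    where bi: "\<And>i j. apply_bcontfun (h i) (x j) = (if i = j then 1 else 0)"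
    by (rule biorthogonal_bumps[OF assms(1,2)]) blast
  obtain \<B> :: "'a set set" where \<B>: "countable \<B>" "\<And>C. C \<in> \<B> \<Longrightarrow> closed C"
    "\<And>U x. open U \<Longrightarrow> x \<in> U \<Longrightarrow> \<exists>C\<in>\<B>. x \<in> C \<and> C \<subseteq> U"
    by (rule countable_closed_network[OF assms(1,2)]) blast
  have H: "Hausdorff_space (euclidean :: 'a topology)"
    using assms(2) by (rule metrizable_imp_Hausdorff_space)
  define A where "A t = bounded_displacement \<Phi> (weighted_evaluation x t)" for t
  \<comment> \<open>Any point would do: it pads tuples to sequences, so that a unique tuple means a
    unique sequence.\<close>
  define p where "p = x 0"
  \<comment> \<open>The supporting tuples of length \<open>n\<close>, confined to a box of closed
    sets from \<open>\<B>\<close> that isolates one of them.\<close>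
  define K where "K n m bs = {z :: (nat \<Rightarrow> real) \<times> (nat \<Rightarrow> 'a). fst z \<in> cube \<and> supports m (A (fst z)) n (snd z) \<and>
      (\<forall>l\<ge>n. snd z l = p) \<and> (\<forall>l<n. snd z l \<in> bs ! l)}" for n m and bs :: "'a set list"
  define J where "J = {(n :: nat, m :: nat, bs). length bs = n \<and> set bs \<subseteq> \<B>}"
  have "\<not> cube \<subseteq> (\<Union>j\<in>J. {t. \<exists>!y. (t, y) \<in> (\<lambda>(n, m, bs). K n m bs) j})"
  proof (rule cube_not_covered_by_unique_sections[OF assms(4) H, where n = fst])
    have "J \<subseteq> UNIV \<times> UNIV \<times> lists \<B>" by (auto simp: J_def)
    moreover have "countable ((UNIV :: nat set) \<times> (UNIV :: nat set) \<times> lists \<B>)"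
      by (intro countable_SIGMA countableI_type countable_lists \<B>(1))
    ultimately show "countable J" by (rule countable_subset)
  next
    fix j assume "j \<in> J"
    then obtain n m bs where j: "j = (n, m, bs)" "length bs = n" "set bs \<subseteq> \<B>"
      by (auto simp: J_def)
    have coord: "continuous_on UNIV (\<lambda>z :: (nat \<Rightarrow> real) \<times> (nat \<Rightarrow> 'a). snd z l)" for l
      by (rule continuous_on_product_then_coordinatewise[OF continuous_on_snd[OF continuous_on_id]])
    have clp: "closed {p}"
      using closedin_Hausdorff_sing_eq[OF H, of p] by simp
    have clb: "closed (bs ! l)" if "l < n" for l
      using \<B>(2) j(2,3) that by (meson nth_mem subsetD)
    have cc: "compact (cube \<times> (UNIV :: (nat \<Rightarrow> 'a) set))"
    proof (rule compact_Times[OF compact_cube])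
      show "compact (UNIV :: (nat \<Rightarrow> 'a) set)"
        using compact_PiE_UNIV[of "\<lambda>_. UNIV :: 'a set"] assms(1) by (simp add: compact_space_def)
    qed
    have "closed ({z. supports m (A (fst z)) n (snd z)} \<inter>
        ((\<Inter>l\<in>{n..}. (\<lambda>z. snd z l) -` {p}) \<inter> (\<Inter>l\<in>{..<n}. (\<lambda>z. snd z l) -` (bs ! l))))"
      unfolding A_def
      by (intro closed_Int closed_supports closed_INT ballI closed_vimage clp coord) (simp add: clb)
    from compact_Int_closed[OF cc this]
    have "compact (K n m bs)"
      by (rule back_subst[of compact]) (auto simp: K_def)
    then show "compact ((\<lambda>(n, m, bs). K n m bs) j)" using j(1) by simp
    fix y :: "nat \<Rightarrow> 'a"
    have "partitionable fst {z :: (nat \<Rightarrow> real) \<times> (nat \<Rightarrow> 'a). fst z \<in> cube \<and> supports m (A (fst z)) n y}"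
      unfolding A_def using hom bi by (rule partitionable_supports)
    moreover have "{z \<in> K n m bs. \<forall>l<n. snd z l = y l} \<subseteq>
        {z. fst z \<in> cube \<and> supports m (A (fst z)) n y}"
      by (auto simp: K_def supports_def)
    ultimately show "partitionable fst {z \<in> (\<lambda>(n, m, bs). K n m bs) j. \<forall>l<fst j. snd z l = y l}"
      using partitionable_subset j(1) by simp
  qed
  moreover have "cube \<subseteq> (\<Union>j\<in>J. {t. \<exists>!y. (t, y) \<in> (\<lambda>(n, m, bs). K n m bs) j})"
  proof
    fix t assume t: "t \<in> cube"
    \<comment> \<open>The least length is taken over all bounds \<open>m\<close> at once; minimality
      for the particular \<open>m\<close> found below follows.\<close>
    define Q where "Q n = (\<exists>m y. supports m (A t) n y)" for n
    have "\<exists>n. Q n"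
      unfolding Q_def A_def by (rule ex_support_bounded_displacement[OF cont])
    then obtain n where "Q n" and least: "\<forall>k<n. \<not> Q k"
      unfolding exists_least_iff[of Q] by blast
    then obtain m y0 where y0: "supports m (A t) n y0"
      unfolding Q_def by blast
    define y where "y l = (if l < n then y0 l else p)" for l
    have y: "supports m (A t) n y"
      using y0 by (simp add: supports_def y_def)
    have min: "\<forall>k<n. \<forall>y'. \<not> supports m (A t) k y'"
      using least unfolding Q_def by blast
    have "openin pointwise_topology (- A t)"
      unfolding A_def by (rule openin_Compl_bounded_displacement[OF cont])
    from isolated_support[OF assms(1,2) this min, where y = y]
    obtain U where U: "\<forall>l. open (U l) \<and> y l \<in> U l"
      "\<forall>y'. supports m (A t) n y' \<longrightarrow> (\<forall>l<n. y' l \<in> U l) \<longrightarrow> (\<forall>l<n. y' l = y l)"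
      by blast
    \<comment> \<open>The isolating open sets depend on \<open>t\<close>; shrinking them to members
      of \<open>\<B>\<close> leaves only countably many boxes.\<close>
    have "\<forall>l. \<exists>C. C \<in> \<B> \<and> y l \<in> C \<and> C \<subseteq> U l"
    proof
      fix l
      have "open (U l)" "y l \<in> U l" using U(1) by simp_all
      from \<B>(3)[OF this] show "\<exists>C. C \<in> \<B> \<and> y l \<in> C \<and> C \<subseteq> U l" by blast
    qed
    then have "\<exists>C. \<forall>l. C l \<in> \<B> \<and> y l \<in> C l \<and> C l \<subseteq> U l" by (rule choice)
    then obtain C where C: "\<forall>l. C l \<in> \<B> \<and> y l \<in> C l \<and> C l \<subseteq> U l" by (rule exE)
    have "\<exists>!y. (t, y) \<in> K n m (map C [0..<n])"
    proof (rule ex1I)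
      show "(t, y) \<in> K n m (map C [0..<n])"
      proof -
        have "\<forall>l\<ge>n. y l = p" by (simp add: y_def)
        moreover have "\<forall>l<n. y l \<in> C l" using C by blast
        ultimately show ?thesis using t y by (simp add: K_def)
      qed
      fix y' assume "(t, y') \<in> K n m (map C [0..<n])"
      then have s: "supports m (A t) n y'" and o: "\<forall>l\<ge>n. y' l = p" and c: "\<forall>l<n. y' l \<in> C l"
        by (auto simp: K_def)
      have "\<forall>l<n. y' l \<in> U l" using c C by blast
      with U(2) s have "\<forall>l<n. y' l = y l" by blast
      then show "y' = y" using o by (intro ext) (metis not_less y_def)
    qed
    moreover have "(n, m, map C [0..<n]) \<in> J"
      using C by (auto simp: J_def)
    ultimately show "t \<in> (\<Union>j\<in>J. {t. \<exists>!y. (t, y) \<in> (\<lambda>(n, m, bs). K n m bs) j})"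
      by (intro UN_I[of "(n, m, map C [0..<n])"]) simp_all
  qed
  ultimately show False by blast
qed

end
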